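(* Let $(Z,\mathcal A)$ be a measurable space, $\mathcal F$ a convex set of bounded measurable functions from $Z$ to $\mathbb R$, $C:\mathcal F\times Z\to[0,\infty)$ a convex, line-continuous cost function, and $P$ a probability measure on $Z$. Assume that a minimizer $f_{P,\mathcal F}\in\mathcal F$ of $f\mapsto\mathcal R_{C,P}(f)$ exists and that for every $n\ge1$ and every $T\in Z^n$ a minimizer $f_{T,\mathcal F}\in\mathcal F$ of $f\mapsto\mathcal R_{C,T}(f)$ exists. Assume that $\mathcal G:=\{C\circ f-C\circ f_{P,\mathcal F}: f\in\mathcal F\}$ is separable with respect to $\|\cdot\|_\infty$, and that there are constants $b,B\ge0$, $\beta\in[0,1]$, $w,W\ge0$, $\nu\in[0,2]$, $\vartheta\in[0,2)$ such that for all $g\in\mathcal G$ $$\|g\|_\infty\le b(\mathbb E_Pg)^\beta+B\quad\text{and}\quad \mathbb E_Pg^2\le\big(b(\mathbb E_Pg)^\beta+B\big)^\nu\big(w(\mathbb E_Pg)^\vartheta+W\big).$$ Then for all $n\ge1$, $x\ge1$ and $\varepsilon>0$ satisfying $$\varepsilon\ge3\,\omega_{P,n}(\mathcal G,\varepsilon)+\sqrt{\frac{2x(b\varepsilon^\beta+B)^\nu(w\varepsilon^\vartheta+W)}{n}}+\frac{2x(b\varepsilon^\beta+B)}{n}$$ we have $$\Pr{}^*\big(T\in Z^n:\ \mathcal R_{C,P}(f_{T,\mathcal F})<\mathcal R_{C,P}(f_{P,\mathcal F})+\varepsilon\big)\ge1-e^{-x},$$ where $\Pr^*$ denotes outer probability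 with respect to $P^n$.
   Context: A cost function is a map $C:\mathcal F\times Z\to[0,\infty)$ such that $C\circ f:=C(f,\cdot)$ is measurable for every $f\in\mathcal F$; $\mathcal R_{C,P}(f):=\mathbb E_{z\sim P}C(f,z)$, and for $T=(z_1,\dots,z_n)$, $\mathcal R_{C,T}(f):=\frac1n\sum_iC(f,z_i)$. $C$ is convex if $C(\cdot,z)$ is convex on $\mathcal F$ for every $z$, and line-continuous if for all $z\in Z$ and $f,\hat f\in\mathcal F$ the map $t\mapsto C(tf+(1-t)\hat f,z)$ is continuous on $[0,1]$. For a class $\mathcal G$ of bounded measurable functions on $Z$ separable w.r.t. $\|\cdot\|_\infty$, the modulus of continuity is $\omega_{P,n}(\mathcal G,\varepsilon):=\mathbb E_{T\sim P^n}\sup\{|\mathbb E_Pg-\mathbb E_Tg|: g\in\mathcal G,\ \mathbb E_Pg\le\varepsilon\}$, where $\mathbb E_T g=\frac1n\sum_i g(z_i)$. *)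

theory Defs
  imports "HOL-Probability.Probability"
begin

text \<open>Real power with the convention 0 to the power 0 equals 1 (as in the paper);
  only used for nonnegative bases.\<close>
definition pw :: "real \<Rightarrow> real \<Rightarrow> real" where
  "pw x a = (if a = 0 then 1 else x powr a)"

definition risk :: "(('z \<Rightarrow> real) \<Rightarrow> 'z \<Rightarrow> real) \<Rightarrow> 'z measure \<Rightarrow> ('z \<Rightarrow> real) \<Rightarrow> real" where
  "risk C P f = (\<integral>z. C f z \<partial>P)"

definition emp_risk :: "(('z \<Rightarrow> real) \<Rightarrow> 'z \<Rightarrow> real) \<Rightarrow> nat \<Rightarrow> (nat \<Rightarrow> 'z) \<Rightarrow> ('z \<Rightarrow> real) \<Rightarrow> real" where
  "emp_risk C n T f = (\<Sum>i<n. C f (T i)) / real n"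

definition sample_measure :: "'z measure \<Rightarrow> nat \<Rightarrow> (nat \<Rightarrow> 'z) measure" where
  "sample_measure P n = PiM {0..<n} (\<lambda>_. P)"

definition modulus :: "'z measure \<Rightarrow> nat \<Rightarrow> ('z \<Rightarrow> real) set \<Rightarrow> real \<Rightarrow> real" where
  "modulus P n G eps =
     (\<integral>T. (SUP g\<in>{g\<in>G. (\<integral>z. g z \<partial>P) \<le> eps}.
              \<bar>(\<integral>z. g z \<partial>P) - (\<Sum>i<n. g (T i)) / real n\<bar>) \<partial>sample_measure P n)"

definition outer_prob :: "'a measure \<Rightarrow> 'a set \<Rightarrow> real" where
  "outer_prob M S = Inf {measure M A | A. A \<in> sets M \<and> S \<subseteq> A}"

definition sup_separable :: "'z set \<Rightarrow> ('z \<Rightarrow> real) set \<Rightarrow> bool" where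
  "sup_separable Z G \<longleftrightarrow> (\<exists>D. countable D \<and> D \<subseteq> G \<and>
      (\<forall>g\<in>G. \<forall>e>0. \<exists>d\<in>D. \<forall>z\<in>Z. \<bar>g z - d z\<bar> \<le> e))"

end

theory Submission
  imports Defs
begin

text \<open>If the empirical minimizer has excess risk at least \<open>\<epsilon>\<close>, then by line-continuity some point on the segment
  towards \<open>fP\<close> has excess risk exactly \<open>\<epsilon>\<close>, and by convexity its empirical excess risk is still nonpositive.
  Hence \<open>\<epsilon> \<le> E g - E_T g\<close> for some \<open>g\<close> with \<open>E g \<le> \<epsilon>\<close>, and it suffices to bound the upper tail of the
  supremum of the empirical process over these \<open>g\<close>. This is done by Bousquet's version of Talagrand's
  inequality, proved by the entropy method: subadditivity of entropy over the coordinates gives a differential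
  inequality for the logarithm of the moment generating function of the supremum over a finite class.
  Separability passes from finite to arbitrary classes; the loss is absorbed because Bousquet's inequality
  needs only \<open>5/3\<close> in place of the constant \<open>2\<close> in the last term of the condition on \<open>\<epsilon>\<close>.\<close>

text \<open>The constants 3 and 5/3 come from one step. For centered functions with values in
  [-1, 1] and variances at most s2, whose supremum of sums over n coordinates has mean at most E,
  Bousquet's threshold is E + sqrt (2x (n s2 + 2E)) + x/3. Splitting off sqrt (4xE) <= 2E + x/2
  gives 3E + sqrt (2x n s2) + 5x/6. If |g| <= K, the functions (E g - g) / (2K) are of this kind,
  and undoing the scaling multiplies by 2K/n, which turns 5x/6 into (5/3) x K / n. Only the sign E g
  - E_T g matters, so a one-sided supremum is enough; its mean is dominated by the two-sided
  modulus. The set of bad samples need not be measurable. It is therefore enclosed in a measurable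
  set of probability at most exp (-x), which is all that a lower bound on outer probability asks
  for. Over a finite class the supremum is attained, and comparing maximizers for different sets of
  coordinates is what drives the entropy argument.\<close>

section \<open>Real inequalities\<close>

text \<open>The right-hand side is smallest at \<open>Y = D\<close>. Then, after division by \<open>exp (l * D)\<close>, the difference of the
  two sides vanishes at \<open>D = 0\<close> (to second order) and at \<open>D = 1\<close> by the choice of \<open>r\<close>, and its second
  derivative changes sign at most once on \<open>D \<le> 1\<close>.\<close>

lemma bousquet_pointwise:
  fixes l D Y :: real
  defines "r \<equiv> (exp l - 1 - l / 2) / (exp l - 1 / 2)"
  assumes l: "0 < l" and D: "D \<le> 1" and Y: "Y \<le> D"
  shows "1 - exp (l * D) + l * D * exp (l * D) \<le> (l - r) * (D * exp (l * D) + Y\<^sup>2 / 2 - Y)"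
    "0 \<le> l - r"
proof -
  have el: "exp l \<ge> 1 + l" by simp
  define c where "c = l - r"
  have den: "exp l - 1 / 2 > 0" using l el by linarith
  have c_eq: "c = (1 - exp l + l * exp l) / (exp l - 1 / 2)"
    unfolding c_def r_def using den by (simp add: field_simps)
  have "exp (- l) \<ge> 1 - l" using exp_ge_add_one_self[of "- l"] by simp
  then have "exp l * (1 - l) \<le> exp l * exp (- l)" by (intro mult_left_mono) auto
  then have "1 - exp l + l * exp l \<ge> 0" by (simp add: algebra_simps flip: exp_add)
  then show c0: "0 \<le> l - r" using den unfolding c_def[symmetric] c_eq by simp
  have rc: "r = l - c" using c_def by simp
  have c0': "0 \<le> c" using c0 c_def by simp
  have r1: "r * (exp l - 1 / 2) = exp l - 1 - l / 2"
    unfolding r_def using den by simp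

  define k where "k = (\<lambda>D. exp (- (l * D)) * (c * (D\<^sup>2 / 2 - D) - 1) + 1 - r * D)"
  define k1 where "k1 = (\<lambda>D. exp (- (l * D)) * (- (l * c * D\<^sup>2 / 2) + (l * c + c) * D + r) - r)"
  \<comment> \<open>\<open>exp (- (l * x)) * q x\<close> is the second derivative of
    \<open>k\<close>. The vertex of this parabola lies at (l + 2) / l > 1, so \<open>q\<close> is
    nonincreasing up to 1.\<close>
  define q where "q = (\<lambda>D. l\<^sup>2 * c / 2 * D\<^sup>2 - l * c * (l + 2) * D + c * (l + 1) - l * r)"
  have dk: "(k has_real_derivative k1 x) (at x)" for x
    unfolding k_def k1_def
    by (auto intro!: derivative_eq_intros simp: rc field_simps power2_eq_square)
  have dk1: "(k1 has_real_derivative exp (- (l * x)) * q x) (at x)" for x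
    unfolding k1_def q_def
    by (auto intro!: derivative_eq_intros simp: rc algebra_simps power2_eq_square)
       (simp add: field_simps)?
  have q_anti: "q y \<le> q x" if "x \<le> y" "y \<le> 1" for x y
  proof -
    have "q x - q y = l * c * (y - x) * ((l + 2) - l * (x + y) / 2)"
      unfolding q_def by (simp add: field_simps power2_eq_square)
    moreover have "l * (x + y) / 2 \<le> l"
      using that l mult_left_mono[of "x + y" 2 l] by simp
    ultimately show ?thesis
      using that l c0' by (smt (verit) mult_nonneg_nonneg)
  qed
  have k0: "k 0 = 0" "k1 0 = 0" unfolding k_def k1_def by auto
  have k1': "k 1 = 0"
  proof -
    have "k 1 = exp (- l) * (- c / 2 - 1) + 1 - r" unfolding k_def by (simp add: field_simps)
    moreover have "exp l * (exp (- l) * (- c / 2 - 1) + 1 - r) = 0"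
    proof -
      have "exp l * (exp (- l) * (- c / 2 - 1) + 1 - r) = (- c / 2 - 1) + exp l - r * exp l"
        by (simp add: algebra_simps flip: exp_add)
      also have "\<dots> = 0" using r1 unfolding c_def by (simp add: field_simps)
      finally show ?thesis .
    qed
    ultimately show ?thesis by simp
  qed
  have q0: "0 \<le> q 0"
  proof -
    \<comment> \<open>\<open>t l\<close> equals
      \<open>2 * exp (- l) * (exp l - 1 / 2) * q 0\<close>. Both \<open>t\<close> and its derivative
      \<open>t1\<close> vanish at 0, and \<open>t1\<close> is nondecreasing on the positive
      axis.\<close>
    define t where "t = (\<lambda>x::real. exp (- x) * (2 + 4 * x + x\<^sup>2) - 2 * (1 + x - x\<^sup>2))"
    define t1 where "t1 = (\<lambda>x::real. exp (- x) * (2 - 2 * x - x\<^sup>2) - 2 + 4 * x)"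
    have dt: "(t has_real_derivative t1 x) (at x)" for x
      unfolding t_def t1_def
      by (auto intro!: derivative_eq_intros simp: algebra_simps power2_eq_square)
    have dt1: "(t1 has_real_derivative exp (- x) * (x\<^sup>2 - 4) + 4) (at x)" for x
      unfolding t1_def
      by (auto intro!: derivative_eq_intros simp: algebra_simps power2_eq_square)
    have t1: "t1 x \<ge> 0" if "x \<ge> 0" for x
    proof -
      have "t1 0 \<le> t1 x"
      proof (rule DERIV_nonneg_imp_nondecreasing[OF that])
        fix y :: real assume y: "0 \<le> y" "y \<le> x"
        have "exp (- y) * 4 \<le> 1 * 4" using y by (intro mult_right_mono) auto
        moreover have "exp (- y) * y\<^sup>2 \<ge> 0" by simp
        ultimately have "exp (- y) * (y\<^sup>2 - 4) + 4 \<ge> 0"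
          unfolding right_diff_distrib by linarith
        then show "\<exists>z. (t1 has_real_derivative z) (at y) \<and> 0 \<le> z" using dt1 by blast
      qed
      then show ?thesis by (simp add: t1_def)
    qed
    have "t 0 \<le> t l"
      using l t1 dt by (intro DERIV_nonneg_imp_nondecreasing[of 0 l t]) (simp, blast)
    then have "0 \<le> exp l * (exp (- l) * (2 + 4 * l + l\<^sup>2) - 2 * (1 + l - l\<^sup>2))"
      by (simp add: t_def)
    also have "\<dots> = 2 + 4 * l + l\<^sup>2 - 2 * exp l * (1 + l - l\<^sup>2)"
      unfolding right_diff_distrib mult.assoc[symmetric] by (simp flip: exp_add)
    finally have *: "2 * exp l * (1 + l - l\<^sup>2) \<le> 2 + 4 * l + l\<^sup>2" by simp
    have "q 0 * (exp l - 1 / 2) = (l * (l + 1)) * (exp l - 1 / 2) - (2 * l + 1) * (r * (exp l - 1 / 2))"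
      unfolding q_def c_def by (simp add: algebra_simps)
    also have "\<dots> = (2 + 4 * l + l\<^sup>2 - 2 * exp l * (1 + l - l\<^sup>2)) / 2"
      unfolding r1 by (simp add: field_simps power2_eq_square)
    also have "\<dots> \<ge> 0" using * by simp
    finally show ?thesis using den by (simp add: zero_le_mult_iff)
  qed
  \<comment> \<open>Left of 0, \<open>k\<close> is convex and vanishes at 0 with its derivative. A
    negative value inside (0, 1) would force \<open>k1\<close> to be negative before it and positive
    after it, since \<open>k\<close> vanishes at both ends; then \<open>q\<close> would be negative
    first and positive later, against its monotonicity.\<close>
  have kD: "0 \<le> k D"
  proof (rule ccontr)
    assume "\<not> 0 \<le> k D"
    then have neg: "k D < 0" by simp
    consider "D < 0" | "0 < D" "D < 1" using neg k0 k1' D by (cases D "0::real" rule: linorder_cases) (auto simp: le_less)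
    then show False
    proof cases
      case 1
      obtain p where p: "D < p" "p < 0" "k 0 - k D = (0 - D) * k1 p"
        using MVT2[OF 1 dk] by auto
      then have "k1 p > 0" using neg k0 1 by (smt (verit) zero_less_mult_pos)
      obtain p' where p': "p < p'" "p' < 0" "k1 0 - k1 p = (0 - p) * (exp (- (l * p')) * q p')"
        using MVT2[OF p(2) dk1] by auto
      have "q p' \<ge> 0" using q_anti[of p' 0] q0 p' by simp
      then have "(0 - p) * (exp (- (l * p')) * q p') \<ge> 0" using p by (intro mult_nonneg_nonneg) auto
      then show False using p' \<open>k1 p > 0\<close> k0 by simp
    next
      case 2
      obtain p where p: "0 < p" "p < D" "k D - k 0 = (D - 0) * k1 p"
        using MVT2[OF 2(1) dk] by auto
      then have kp: "k1 p < 0" using neg k0 2 by (smt (verit) mult_nonneg_nonneg)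
      obtain s where s: "D < s" "s < 1" "k 1 - k D = (1 - D) * k1 s"
        using MVT2[OF 2(2) dk] by auto
      then have ks: "k1 s > 0" using neg k1' 2 by (smt (verit) zero_less_mult_pos)
      obtain p' where p': "0 < p'" "p' < p" "k1 p - k1 0 = (p - 0) * (exp (- (l * p')) * q p')"
        using MVT2[OF p(1) dk1] by auto
      have "q p' < 0"
        using p' kp k0 by (smt (verit) mult_nonneg_nonneg exp_gt_zero)
      have "p < s" using p s by simp
      obtain s' where s': "p < s'" "s' < s" "k1 s - k1 p = (s - p) * (exp (- (l * s')) * q s')"
        using MVT2[OF \<open>p < s\<close> dk1] by auto
      have "(s - p) * exp (- (l * s')) * q s' > 0" using s' kp ks by (simp add: mult.assoc)
      then have "q s' > 0"
        by (rule zero_less_mult_pos) (use \<open>p < s\<close> in auto)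
      then show False using q_anti[of p' s'] s' s p' \<open>q p' < 0\<close> by auto
    qed
  qed
  have "exp (l * D) * k D = c * (D\<^sup>2 / 2 - D) - 1 + exp (l * D) - r * D * exp (l * D)"
  proof -
    have "exp (l * D) * exp (- (l * D)) = 1" by (simp flip: exp_add)
    then show ?thesis unfolding k_def by (simp add: algebra_simps)
  qed
  moreover have "exp (l * D) * k D \<ge> 0" using kD by simp
  moreover have "D\<^sup>2 / 2 - D \<le> Y\<^sup>2 / 2 - Y"
  proof -
    have "(D - Y) * (D + Y - 2) \<le> 0" using D Y by (intro mult_nonneg_nonpos) auto
    then show ?thesis by (simp add: algebra_simps power2_eq_square)
  qed
  then have "c * (D\<^sup>2 / 2 - D) \<le> c * (Y\<^sup>2 / 2 - Y)" using c0' by (intro mult_left_mono)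
  ultimately show "1 - exp (l * D) + l * D * exp (l * D) \<le> (l - r) * (D * exp (l * D) + Y\<^sup>2 / 2 - Y)"
    unfolding c_def[symmetric] by (simp add: algebra_simps c_def)
qed

text \<open>Bernstein's simplification of the Bennett exponent. With the denominator cleared, the
  difference \<open>t\<close> of the two sides vanishes at 0 together with its derivative, and it is
  convex because \<open>exp x * (1 - x) \<le> 1\<close>.\<close>

lemma exp_minus_linear_le:
  fixes l :: real
  assumes "0 \<le> l" "l < 3"
  shows "exp l - 1 - l \<le> l\<^sup>2 / (2 * (1 - l / 3))"
proof -
  define t where "t = (\<lambda>x::real. x\<^sup>2 / 2 - (1 - x / 3) * (exp x - 1 - x))"
  define t1 where "t1 = (\<lambda>x::real. x + (exp x - 1 - x) / 3 - (1 - x / 3) * (exp x - 1))"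
  define t2 where "t2 = (\<lambda>x::real. 1 + 2 * (exp x - 1) / 3 - (1 - x / 3) * exp x)"
  have dt: "(t has_real_derivative t1 x) (at x)" for x
    unfolding t_def t1_def by (auto intro!: derivative_eq_intros simp: field_simps)
  have dt1: "(t1 has_real_derivative t2 x) (at x)" for x
    unfolding t1_def t2_def by (auto intro!: derivative_eq_intros simp: field_simps)
  have t2: "t2 x \<ge> 0" for x
  proof -
    have "exp x * (1 - x) \<le> exp x * exp (- x)"
      using exp_ge_add_one_self[of "- x"] by (intro mult_left_mono) auto
    then have "exp x * (1 - x) \<le> 1" by (simp flip: exp_add)
    then show ?thesis unfolding t2_def by (simp add: field_simps)
  qed
  have t1: "t1 x \<ge> 0" if "x \<ge> 0" for x
  proof -
    have "t1 0 \<le> t1 x" using that t2 dt1 by (intro DERIV_nonneg_imp_nondecreasing[of 0 x t1]) (simp, blast)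
    then show ?thesis by (simp add: t1_def)
  qed
  have "t 0 \<le> t l" using assms t1 dt by (intro DERIV_nonneg_imp_nondecreasing[of 0 l t]) (simp, blast)
  then have "(1 - l / 3) * (exp l - 1 - l) \<le> l\<^sup>2 / 2" by (simp add: t_def)
  then show ?thesis using assms by (simp add: field_simps)
qed

text \<open>For \<open>v > 0\<close> the Bernstein-optimal parameter is \<open>l = q / (1 + q / 3)\<close> with \<open>q = sqrt (2 x / v)\<close>.\<close>

lemma chernoff_parameter_exists:
  fixes E s x t :: real
  assumes E: "0 \<le> E" and s: "0 \<le> s" and x: "0 < x"
    and t: "3 * E + sqrt (2 * x * s) + 5 * x / 6 \<le> t"
  shows "\<exists>l>0. l * E + (2 * E + s) * (exp l - 1 - l) - l * t \<le> - x"
proof (cases "2 * E + s = 0")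
  case True
  then have "E = 0" "s = 0" using E s by auto
  \<comment> \<open>Here \<open>t\<close> is at least 5x/6, so every \<open>l\<close> from 6/5 on
    would do.\<close>
  then show ?thesis using t x by (intro exI[of _ 2]) auto
next
  case False
  define v where "v = 2 * E + s"
  have v: "v > 0" using False E s unfolding v_def by auto
  define q where "q = sqrt (2 * x / v)"
  have q: "q > 0" unfolding q_def using v x by simp
  have q2: "v * q\<^sup>2 = 2 * x" unfolding q_def using v x by simp
  define l where "l = q / (1 + q / 3)"
  have l: "0 < l" "l < 3" unfolding l_def using q by (auto simp: field_simps)
  have l3: "1 - l / 3 = 1 / (1 + q / 3)"
    unfolding l_def using q by (simp add: field_simps)
  have "v * (exp l - 1 - l) \<le> v * (l\<^sup>2 / (2 * (1 - l / 3)))"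
    using exp_minus_linear_le[of l] l v by (intro mult_left_mono) auto
  also have "\<dots> = v * q\<^sup>2 / (2 * (1 + q / 3))"
  proof -
    have "1 + q / 3 \<noteq> 0" using q by simp
    then show ?thesis
      unfolding l3 unfolding l_def by (simp add: power_divide power2_eq_square)
  qed
  also have "\<dots> = x / (1 + q / 3)" unfolding q2 using q by (simp add: field_simps)
  finally have A: "v * (exp l - 1 - l) \<le> x / (1 + q / 3)" .
  have vq: "v * q = sqrt (2 * x * v)"
  proof -
    have "v * q = sqrt ((v * q)\<^sup>2)" using v q by simp
    also have "(v * q)\<^sup>2 = 2 * x * v" using q2 by (simp add: power2_eq_square algebra_simps)
    finally show ?thesis .
  qed
  have "sqrt (2 * x * v) \<le> sqrt (2 * x * s) + sqrt (4 * x * E)"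
    unfolding v_def using sqrt_add_le_add_sqrt[of "2 * x * s" "4 * x * E"] E s x
    by (simp add: algebra_simps)
  \<comment> \<open>The arithmetic-geometric mean inequality. The added 2E and x/2 turn E + x/3 into
    the 3E and 5x/6 of the hypothesis.\<close>
  also have "sqrt (4 * x * E) \<le> 2 * E + x / 2"
  proof (rule real_le_lsqrt)
    show "4 * x * E \<le> (2 * E + x / 2)\<^sup>2"
      using sum_squares_ge_zero[of "2 * E - x / 2" 0] by (simp add: power2_eq_square algebra_simps)
  qed (use E x in auto)
  finally have "E + v * q + x / 3 \<le> t" using t vq by simp
  then have "l * (t - E) \<ge> l * (v * q + x / 3)" using l by (intro mult_left_mono) auto
  \<comment> \<open>The summand x / (1 + q/3) pays for the bound \<open>A\<close>; what remains is
    the required exponent x.\<close>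
  moreover have "l * (v * q + x / 3) = x + x / (1 + q / 3)"
  proof -
    have "l * (v * q + x / 3) = (v * q\<^sup>2 + q * x / 3) / (1 + q / 3)"
      unfolding l_def using q by (simp add: field_simps power2_eq_square)
    also have "\<dots> = x + x / (1 + q / 3)" unfolding q2 using q by (simp add: field_simps)
    finally show ?thesis .
  qed
  ultimately show ?thesis
    using A l unfolding v_def by (intro exI[of _ l]) (auto simp: algebra_simps)
qed

section \<open>Subadditivity of entropy\<close>

lemma (in prob_space) integrable_of_bounded:
  fixes g :: "'a \<Rightarrow> real"
  assumes "g \<in> borel_measurable M" "\<And>x. x \<in> space M \<Longrightarrow> \<bar>g x\<bar> \<le> K"
  shows "integrable M g"
  using assms by (intro integrable_const_bound[where B = K]) (auto intro!: AE_I2)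

lemma (in prob_space) expectation_in_bounds:
  fixes g :: "'a \<Rightarrow> real"
  assumes g: "g \<in> borel_measurable M" and b: "\<And>x. x \<in> space M \<Longrightarrow> g x \<in> {l..h}"
  shows "expectation g \<in> {l..h}"
proof -
  have "integrable M g"
    using g b by (intro integrable_of_bounded[where K = "\<bar>l\<bar> + \<bar>h\<bar>"]) (auto, fastforce)
  then show ?thesis
    using b by (auto intro!: integral_ge_const integral_le_const AE_I2)
qed

lemma abs_ln_le_of_bounds:
  fixes v :: real
  assumes "0 < l" "v \<in> {l..h}"
  shows "\<bar>ln v\<bar> \<le> \<bar>ln l\<bar> + \<bar>ln h\<bar>"
proof -
  have "ln l \<le> ln v" "ln v \<le> ln h" using assms by auto
  then show ?thesis by linarith
qed

text \<open>Variational form of the Bregman divergence of x ln x: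
  \<open>a * (ln a - ln b) - a + b\<close> is the maximum over \<open>r\<close> of
  \<open>a * ln r - b * r + b\<close>, attained at \<open>r = a / b\<close>. For fixed
  \<open>r\<close> these minorants are affine in \<open>a\<close> and \<open>b\<close>, so they can
  be integrated.\<close>

lemma bregman_entropy_ge:
  fixes a b r :: real
  assumes "0 < a" "0 < b" "0 < r"
  shows "a * ln r \<le> a * (ln a - ln b) - a + b * r"
proof -
  have "ln (b * r / a) \<le> b * r / a - 1"
    using assms by (intro ln_le_minus_one) auto
  moreover have "ln (b * r / a) = ln b + ln r - ln a"
    using assms by (simp add: ln_mult ln_div)
  ultimately have "a * (ln b + ln r - ln a) \<le> a * (b * r / a - 1)"
    using assms by (intro mult_left_mono) auto
  then show ?thesis
    using assms by (simp add: algebra_simps)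
qed

lemma (in prob_space) integrable_bregman:
  fixes f u :: "'a \<Rightarrow> real"
  assumes l: "0 < l"
    and f [measurable]: "f \<in> borel_measurable M" and fb: "\<And>x. x \<in> space M \<Longrightarrow> f x \<in> {l..h}"
    and u [measurable]: "u \<in> borel_measurable M" and ub: "\<And>x. x \<in> space M \<Longrightarrow> u x \<in> {l..h}"
  shows "integrable M f" "integrable M u" "integrable M (\<lambda>x. f x * ln (f x))"
    "integrable M (\<lambda>x. f x * (ln (f x) - ln (u x)) - f x + u x)"
proof -
  let ?L = "\<bar>ln l\<bar> + \<bar>ln h\<bar>"
  have fL: "\<bar>f x * ln (f x)\<bar> \<le> h * ?L" if "x \<in> space M" for x
    unfolding abs_mult
    using fb[OF that] l abs_ln_le_of_bounds[OF l fb[OF that]] by (intro mult_mono) auto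
  have uL: "\<bar>f x * ln (u x)\<bar> \<le> h * ?L" if "x \<in> space M" for x
    unfolding abs_mult
    using fb[OF that] l abs_ln_le_of_bounds[OF l ub[OF that]] by (intro mult_mono) auto
  show 1: "integrable M f"
    using fb l by (intro integrable_of_bounded[where K = h]) (auto, fastforce)
  show 2: "integrable M u"
    using ub l by (intro integrable_of_bounded[where K = h]) (auto, fastforce)
  show 3: "integrable M (\<lambda>x. f x * ln (f x))"
    using fL by (intro integrable_of_bounded) auto
  have 4: "integrable M (\<lambda>x. f x * ln (u x))"
    using uL by (intro integrable_of_bounded) auto
  show "integrable M (\<lambda>x. f x * (ln (f x) - ln (u x)) - f x + u x)"
    unfolding right_diff_distrib using 1 2 3 4 by auto
qed

text \<open>Joint convexity of the divergence: integrate the affine minorant whose \<open>r\<close>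
  is the ratio of the two expectations, where it is exact for the averaged pair.\<close>

lemma (in prob_space) bregman_jensen:
  fixes f u :: "'a \<Rightarrow> real"
  assumes l: "0 < l"
    and f [measurable]: "f \<in> borel_measurable M" and fb: "\<And>x. x \<in> space M \<Longrightarrow> f x \<in> {l..h}"
    and u [measurable]: "u \<in> borel_measurable M" and ub: "\<And>x. x \<in> space M \<Longrightarrow> u x \<in> {l..h}"
  shows "expectation f * (ln (expectation f) - ln (expectation u)) - expectation f + expectation u
    \<le> expectation (\<lambda>x. f x * (ln (f x) - ln (u x)) - f x + u x)"
proof -
  note int = integrable_bregman[OF l f fb u ub]
  let ?f = "expectation f" and ?u = "expectation u"
  have pos: "?f > 0" "?u > 0"
    using expectation_in_bounds[OF f fb] expectation_in_bounds[OF u ub] l by auto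
  have "expectation (\<lambda>x. f x * ln (?f / ?u) - u x * (?f / ?u) + u x)
      \<le> expectation (\<lambda>x. f x * (ln (f x) - ln (u x)) - f x + u x)"
  proof (intro integral_mono)
    fix x assume x: "x \<in> space M"
    have "0 < f x" "0 < u x" using fb[OF x] ub[OF x] l by auto
    from bregman_entropy_ge[OF this, of "?f / ?u"] pos
    show "f x * ln (?f / ?u) - u x * (?f / ?u) + u x
      \<le> f x * (ln (f x) - ln (u x)) - f x + u x" by auto
  qed (use int in auto)
  also have "expectation (\<lambda>x. f x * ln (?f / ?u) - u x * (?f / ?u) + u x)
     = ?f * ln (?f / ?u) - ?u * (?f / ?u) + ?u"
    using int by simp
  finally show ?thesis
    using pos by (simp add: ln_div)
qed

text \<open>Entropy is the least expected divergence from a constant. The gap at \<open>c\<close> is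
  the divergence of \<open>expectation f\<close> from \<open>c\<close>, which is nonnegative by the
  case \<open>r = 1\<close> of the variational form.\<close>

lemma (in prob_space) entropy_le_bregman_const:
  fixes f :: "'a \<Rightarrow> real"
  assumes l: "0 < l"
    and f [measurable]: "f \<in> borel_measurable M" and fb: "\<And>x. x \<in> space M \<Longrightarrow> f x \<in> {l..h}"
    and c: "c \<in> {l..h}" and u: "\<And>x. x \<in> space M \<Longrightarrow> u x = c"
  shows "expectation (\<lambda>x. f x * ln (f x)) - expectation f * ln (expectation f)
    \<le> expectation (\<lambda>x. f x * (ln (f x) - ln (u x)) - f x + u x)"
proof -
  have "c > 0" "expectation f > 0"
    using expectation_in_bounds[OF f fb] c l by auto
  from bregman_entropy_ge[OF this(2,1), of 1]
  have "0 \<le> expectation f * (ln (expectation f) - ln c) - expectation f + c" by simp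
  moreover have "expectation (\<lambda>x. f x * (ln (f x) - ln (u x)) - f x + u x)
     = expectation (\<lambda>x. f x * ln (f x) - f x * ln c - f x + c)"
    by (intro Bochner_Integration.integral_cong) (auto simp: u algebra_simps)
  moreover have "expectation (\<lambda>x. f x * ln (f x) - f x * ln c - f x + c)
     = expectation (\<lambda>x. f x * ln (f x)) - expectation f * ln c - expectation f + c"
    using integrable_bregman(1,3)[OF l f fb f fb] by (simp add: prob_space)
  ultimately show ?thesis by (simp add: right_diff_distrib)
qed

section \<open>Coordinate sections of functions on a product space\<close>

lemma measurable_fun_upd_section:
  assumes f: "f \<in> borel_measurable (PiM (insert j I) (\<lambda>_. P))"
  shows "(\<lambda>(x, y). f (x(j := y))) \<in> borel_measurable (PiM I (\<lambda>_. P) \<Otimes>\<^sub>M P)"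
  using measurable_compose[OF measurable_add_dim[of j I "\<lambda>_. P"] f]
  by (simp add: case_prod_beta')

lemma space_PiM_fun_upd:
  "x \<in> space (PiM I (\<lambda>_. P)) \<Longrightarrow> y \<in> space P \<Longrightarrow> x(j := y) \<in> space (PiM (insert j I) (\<lambda>_. P))"
  by (auto simp: space_PiM PiE_def extensional_def)

lemma measurable_fun_upd_section':
  assumes f: "f \<in> borel_measurable (PiM (insert j I) (\<lambda>_. P))" and x: "x \<in> space (PiM I (\<lambda>_. P))"
  shows "(\<lambda>y. f (x(j := y))) \<in> borel_measurable P"
  using measurable_Pair2[OF measurable_fun_upd_section[OF f] x] by simp

lemma (in prob_space) integrable_section_integral:
  fixes g :: "('i \<Rightarrow> 'a) \<Rightarrow> real"
  assumes g: "g \<in> borel_measurable (PiM (insert j I) (\<lambda>_. M))"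
    and b: "\<And>x. x \<in> space (PiM (insert j I) (\<lambda>_. M)) \<Longrightarrow> g x \<in> {lo..hi}"
  shows "integrable (PiM I (\<lambda>_. M)) (\<lambda>x. \<integral>y. g (x(j := y)) \<partial>M)"
proof -
  interpret I: prob_space "PiM I (\<lambda>_. M)" by (intro prob_space_PiM prob_space_axioms)
  show ?thesis
  proof (rule I.integrable_of_bounded[where K = "\<bar>lo\<bar> + \<bar>hi\<bar>"])
    show "(\<lambda>x. \<integral>y. g (x(j := y)) \<partial>M) \<in> borel_measurable (PiM I (\<lambda>_. M))"
      by (intro borel_measurable_lebesgue_integral measurable_fun_upd_section g)
    fix x assume "x \<in> space (PiM I (\<lambda>_. M))"
    then have "(\<integral>y. g (x(j := y)) \<partial>M) \<in> {lo..hi}"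
      by (intro expectation_in_bounds measurable_fun_upd_section'[OF g] b space_PiM_fun_upd)
    then show "\<bar>\<integral>y. g (x(j := y)) \<partial>M\<bar> \<le> \<bar>lo\<bar> + \<bar>hi\<bar>" by auto
  qed
qed

text \<open>Integrating out \<open>j\<close> splits the entropy of \<open>f\<close> into the
  expected entropy of its sections along \<open>j\<close> and the entropy of the averaged function
  \<open>f'\<close>. Comparing with arbitrary \<open>u i\<close> that ignore coordinate
  \<open>i\<close>, instead of with conditional expectations of \<open>f\<close>, keeps the claim
  stable under averaging, so the induction hypothesis applies to \<open>f'\<close> and the averages
  \<open>u' i\<close>.\<close>

lemma (in prob_space) entropy_tensorization:
  fixes f :: "('i \<Rightarrow> 'a) \<Rightarrow> real" and u :: "'i \<Rightarrow> ('i \<Rightarrow> 'a) \<Rightarrow> real"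
  assumes I: "finite I" and l: "0 < l"
    and "f \<in> borel_measurable (PiM I (\<lambda>_. M))"
    and "\<And>x. x \<in> space (PiM I (\<lambda>_. M)) \<Longrightarrow> f x \<in> {l..h}"
    and "\<And>i. i \<in> I \<Longrightarrow> u i \<in> borel_measurable (PiM I (\<lambda>_. M))"
    and "\<And>i x. i \<in> I \<Longrightarrow> x \<in> space (PiM I (\<lambda>_. M)) \<Longrightarrow> u i x \<in> {l..h}"
    and "\<And>i x y. i \<in> I \<Longrightarrow> x \<in> space (PiM I (\<lambda>_. M)) \<Longrightarrow> y \<in> space M \<Longrightarrow> u i (x(i := y)) = u i x"
  shows "(\<integral>x. f x * ln (f x) \<partial>PiM I (\<lambda>_. M))
      - (\<integral>x. f x \<partial>PiM I (\<lambda>_. M)) * ln (\<integral>x. f x \<partial>PiM I (\<lambda>_. M))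
    \<le> (\<Sum>i\<in>I. \<integral>x. (f x * (ln (f x) - ln (u i x)) - f x + u i x) \<partial>PiM I (\<lambda>_. M))"
  using I assms(3-)
proof (induction I arbitrary: f u rule: finite_induct)
  case empty
  show ?case by (simp add: PiM_empty lebesgue_integral_count_space_finite)
next
  case (insert j I)
  interpret I: prob_space "PiM I (\<lambda>_. M)" by (intro prob_space_PiM prob_space_axioms)
  interpret J: prob_space "PiM (insert j I) (\<lambda>_. M)" by (intro prob_space_PiM prob_space_axioms)
  interpret PS: product_sigma_finite "\<lambda>_::'i. M" by standard
  note fb = insert.prems(2) and ub = insert.prems(4) and uc = insert.prems(5)
  have f [measurable]: "f \<in> borel_measurable (PiM (insert j I) (\<lambda>_. M))" by (fact insert.prems(1))
  have um: "i \<in> insert j I \<Longrightarrow> u i \<in> borel_measurable (PiM (insert j I) (\<lambda>_. M))" for i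
    by (fact insert.prems(3))
  let ?I = "PiM I (\<lambda>_. M)" and ?J = "PiM (insert j I) (\<lambda>_. M)"
  define f' where "f' = (\<lambda>x. \<integral>y. f (x(j := y)) \<partial>M)"
  define u' where "u' = (\<lambda>i x. \<integral>y. u i (x(j := y)) \<partial>M)"
  define d where "d = (\<lambda>i x. f x * (ln (f x) - ln (u i x)) - f x + u i x)"
  have f'm [measurable]: "f' \<in> borel_measurable ?I"
    unfolding f'_def by (intro borel_measurable_lebesgue_integral measurable_fun_upd_section f)
  have u'm: "u' i \<in> borel_measurable ?I" if "i \<in> insert j I" for i
    unfolding u'_def by (intro borel_measurable_lebesgue_integral measurable_fun_upd_section um that)
  have f'b: "f' x \<in> {l..h}" if "x \<in> space ?I" for x
    unfolding f'_def using that
    by (intro expectation_in_bounds measurable_fun_upd_section'[OF f] fb space_PiM_fun_upd)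
  have u'b: "u' i x \<in> {l..h}" if "x \<in> space ?I" "i \<in> insert j I" for i x
    unfolding u'_def using that
    by (intro expectation_in_bounds measurable_fun_upd_section'[OF um] ub space_PiM_fun_upd)
  have u'c: "u' i (x(i := y)) = u' i x" if i: "i \<in> I" and x: "x \<in> space ?I" and y: "y \<in> space M" for i x y
  proof -
    have "i \<noteq> j" using i insert.hyps by auto
    then have "u i (x(i := y, j := z)) = u i (x(j := z))" if "z \<in> space M" for z
      using uc[OF _ space_PiM_fun_upd[OF x that] y, of i] i by (metis fun_upd_twist insertCI)
    then show ?thesis
      unfolding u'_def by (intro Bochner_Integration.integral_cong) auto
  qed
  have dm: "d i \<in> borel_measurable ?J" if "i \<in> insert j I" for i
    using um[OF that] unfolding d_def by measurable
  have dint: "integrable ?J (d i)" if "i \<in> insert j I" for i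
    unfolding d_def using that by (intro J.integrable_bregman[OF l f fb um ub])
  define S where "S = (\<lambda>x. \<integral>y. f (x(j := y)) * ln (f (x(j := y))) \<partial>M)"
  have fubini: "(\<integral>x. g x \<partial>?J) = (\<integral>x. (\<integral>y. g (x(j := y)) \<partial>M) \<partial>?I)" if "integrable ?J g" for g :: "_ \<Rightarrow> real"
    using PS.product_integral_insert[OF insert.hyps that] .
  note secint = integrable_section_integral[of _ j I]
  let ?L = "\<bar>ln l\<bar> + \<bar>ln h\<bar>"
  have lnb: "\<bar>a * ln b\<bar> \<le> h * ?L" if "a \<in> {l..h}" "b \<in> {l..h}" for a b :: real
    unfolding abs_mult using that l abs_ln_le_of_bounds[OF l that(2)] by (intro mult_mono) auto
  have Sint: "integrable ?I S"
    unfolding S_def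
  proof (rule secint[where lo = "- (h * ?L)" and hi = "h * ?L"])
    fix x assume x: "x \<in> space ?J"
    show "f x * ln (f x) \<in> {- (h * ?L)..h * ?L}"
      using lnb[OF fb[OF x] fb[OF x]] unfolding atLeastAtMost_iff abs_le_iff by linarith
  qed measurable
  have dsec: "integrable ?I (\<lambda>x. \<integral>y. d i (x(j := y)) \<partial>M)" if i: "i \<in> insert j I" for i
  proof (rule secint[OF dm[OF i], where lo = "- (2 * (h * ?L) + 2 * h)" and hi = "2 * (h * ?L) + 2 * h"])
    fix x assume x: "x \<in> space ?J"
    show "d i x \<in> {- (2 * (h * ?L) + 2 * h)..2 * (h * ?L) + 2 * h}"
      using lnb[OF fb[OF x] fb[OF x]] lnb[OF fb[OF x] ub[OF i x]] fb[OF x] ub[OF i x] l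
      unfolding d_def right_diff_distrib atLeastAtMost_iff abs_le_iff by linarith
  qed
  have f'int: "integrable ?I (\<lambda>x. f' x * ln (f' x))"
    by (rule I.integrable_bregman(3)[OF l f'm f'b f'm f'b])
  \<comment> \<open>Along coordinate \<open>j\<close> the function \<open>u j\<close> is constant,
    so it may serve as the constant in the bound for the entropy of each section.\<close>
  have A: "(\<integral>x. S x - f' x * ln (f' x) \<partial>?I) \<le> (\<integral>x. (\<integral>y. d j (x(j := y)) \<partial>M) \<partial>?I)"
  proof (intro integral_mono)
    fix x assume x: "x \<in> space ?I"
    obtain y0 where y0: "y0 \<in> space M" using not_empty by auto
    have c: "u j (x(j := y)) = u j (x(j := y0))" if "y \<in> space M" for y
      using uc[OF _ space_PiM_fun_upd[OF x y0] that, of j] by (metis fun_upd_upd insertI1)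
    show "S x - f' x * ln (f' x) \<le> (\<integral>y. d j (x(j := y)) \<partial>M)"
      unfolding S_def f'_def d_def
      by (rule entropy_le_bregman_const[OF l measurable_fun_upd_section'[OF f x] _ _ c])
         (use x y0 in \<open>auto intro!: fb ub space_PiM_fun_upd simp del: atLeastAtMost_iff fun_upd_apply\<close>)
  qed (use Sint f'int dsec in auto)
  \<comment> \<open>By joint convexity, averaging over \<open>j\<close> does not increase the
    divergence; this carries the induction hypothesis back from \<open>f'\<close> and
    \<open>u'\<close> to \<open>f\<close> and \<open>u\<close>.\<close>
  have B: "(\<integral>x. f' x * (ln (f' x) - ln (u' i x)) - f' x + u' i x \<partial>?I)
      \<le> (\<integral>x. (\<integral>y. d i (x(j := y)) \<partial>M) \<partial>?I)" if i: "i \<in> I" for i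
  proof (intro integral_mono)
    have i': "i \<in> insert j I" using i by simp
    show "integrable ?I (\<lambda>x. f' x * (ln (f' x) - ln (u' i x)) - f' x + u' i x)"
      by (rule I.integrable_bregman(4)[OF l f'm f'b u'm[OF i'] u'b[OF _ i']])
    show "integrable ?I (\<lambda>x. \<integral>y. d i (x(j := y)) \<partial>M)" by (rule dsec[OF i'])
    fix x assume x: "x \<in> space ?I"
    show "f' x * (ln (f' x) - ln (u' i x)) - f' x + u' i x \<le> (\<integral>y. d i (x(j := y)) \<partial>M)"
      unfolding f'_def u'_def d_def
      by (rule bregman_jensen[OF l measurable_fun_upd_section'[OF f x] _ measurable_fun_upd_section'[OF um[OF i'] x]])
         (use x i' in \<open>auto intro!: fb ub space_PiM_fun_upd simp del: atLeastAtMost_iff fun_upd_apply\<close>)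
  qed
  have IH: "(\<integral>x. f' x * ln (f' x) \<partial>?I) - (\<integral>x. f' x \<partial>?I) * ln (\<integral>x. f' x \<partial>?I)
    \<le> (\<Sum>i\<in>I. \<integral>x. (f' x * (ln (f' x) - ln (u' i x)) - f' x + u' i x) \<partial>?I)"
    by (rule insert.IH[OF f'm f'b u'm u'b u'c]) auto
  have "(\<integral>x. f x * ln (f x) \<partial>?J) = (\<integral>x. S x \<partial>?I)"
    unfolding S_def by (intro fubini J.integrable_bregman(3)[OF l f fb f fb])
  also have "\<dots> = (\<integral>x. S x - f' x * ln (f' x) \<partial>?I) + (\<integral>x. f' x * ln (f' x) \<partial>?I)"
    using Sint f'int by simp
  finally have "(\<integral>x. f x * ln (f x) \<partial>?J) - (\<integral>x. f' x \<partial>?I) * ln (\<integral>x. f' x \<partial>?I)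
     \<le> (\<integral>x. (\<integral>y. d j (x(j := y)) \<partial>M) \<partial>?I) + (\<Sum>i\<in>I. \<integral>x. (\<integral>y. d i (x(j := y)) \<partial>M) \<partial>?I)"
    using A IH sum_mono[OF B] by fastforce
  also have "\<dots> = (\<Sum>i\<in>insert j I. \<integral>x. d i x \<partial>?J)"
    using insert.hyps dint by (simp add: fubini)
  also have "(\<integral>x. f' x \<partial>?I) = (\<integral>x. f x \<partial>?J)"
    unfolding f'_def by (intro fubini[symmetric] J.integrable_bregman(1)[OF l f fb f fb])
  finally show ?case by (simp add: d_def)
qed

section \<open>Moment generating functions\<close>

text \<open>A crude Taylor remainder, made for differentiating under the integral. It passes through
  \<open>u * (exp u - 1)\<close>, which dominates \<open>exp u - 1 - u\<close> for either sign of
  \<open>u\<close>.\<close>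

lemma exp_minus_linear_bounds:
  fixes u :: real
  shows "0 \<le> exp u - 1 - u" "exp u - 1 - u \<le> u\<^sup>2 * exp \<bar>u\<bar>"
proof -
  show "0 \<le> exp u - 1 - u" using exp_ge_add_one_self[of u] by linarith
  have key: "exp v - 1 \<le> v * exp v" for v :: real
  proof -
    have "exp v * (1 - v) \<le> exp v * exp (- v)"
      using exp_ge_add_one_self[of "- v"] by (intro mult_left_mono) auto
    then show ?thesis by (simp add: algebra_simps flip: exp_add)
  qed
  have "u * (exp u - 1) \<le> u * (u * exp \<bar>u\<bar>)"
  proof (cases "u \<ge> 0")
    case True
    then show ?thesis using key[of u] by (intro mult_left_mono) auto
  next
    case False
    have "u * exp \<bar>u\<bar> \<le> u * 1" using False by (intro mult_left_mono_neg) auto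
    also have "\<dots> \<le> exp u - 1" using exp_ge_add_one_self[of u] by linarith
    finally show ?thesis using False by (intro mult_left_mono_neg) auto
  qed
  then show "exp u - 1 - u \<le> u\<^sup>2 * exp \<bar>u\<bar>"
    using key[of u] by (simp add: algebra_simps power2_eq_square)
qed

text \<open>Since \<open>Z\<close> is bounded, the Taylor remainder is of order h^2 uniformly on the
  space; integrating it bounds the error of the difference quotient by a multiple of |h|.\<close>

lemma (in prob_space) has_real_derivative_mgf:
  fixes Z :: "'a \<Rightarrow> real"
  assumes Z [measurable]: "Z \<in> borel_measurable M" and K: "\<And>x. x \<in> space M \<Longrightarrow> \<bar>Z x\<bar> \<le> K"
  shows "((\<lambda>t. expectation (\<lambda>x. exp (t * Z x))) has_real_derivative expectation (\<lambda>x. Z x * exp (t * Z x))) (at t)"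
proof -
  have tZ: "\<bar>t * Z x\<bar> \<le> \<bar>t\<bar> * K" if "x \<in> space M" for x t
    unfolding abs_mult using K[OF that] by (intro mult_left_mono) auto
  have ex: "exp (t * Z x) \<le> exp (\<bar>t\<bar> * K)" if "x \<in> space M" for x t
    using tZ[OF that, of t] by auto
  have K0: "0 \<le> K" using K not_empty by (meson abs_ge_zero ex_in_conv order_trans)
  have i0: "integrable M (\<lambda>x. exp (t * Z x))" for t
    using ex by (intro integrable_of_bounded[where K = "exp (\<bar>t\<bar> * K)"]) auto
  have i1: "integrable M (\<lambda>x. Z x * exp (t * Z x))" for t
  proof (rule integrable_of_bounded[where K = "K * exp (\<bar>t\<bar> * K)"])
    fix x assume "x \<in> space M"
    then show "\<bar>Z x * exp (t * Z x)\<bar> \<le> K * exp (\<bar>t\<bar> * K)"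
      unfolding abs_mult abs_exp_cancel using ex K K0 by (intro mult_mono) auto
  qed measurable
  let ?F = "\<lambda>t. expectation (\<lambda>x. exp (t * Z x))" and ?D = "expectation (\<lambda>x. Z x * exp (t * Z x))"
  let ?C = "exp (\<bar>t\<bar> * K) * (K\<^sup>2 * exp K)"
  have est: "\<bar>?F (t + h) - ?F t - h * ?D\<bar> \<le> h\<^sup>2 * ?C" if h: "\<bar>h\<bar> \<le> 1" for h
  proof -
    have "?F (t + h) - ?F t - h * ?D = expectation (\<lambda>x. exp ((t + h) * Z x) - exp (t * Z x) - h * (Z x * exp (t * Z x)))"
      using i0[of "t + h"] i0[of t] i1[of t] by simp
    also have "\<dots> = expectation (\<lambda>x. exp (t * Z x) * (exp (h * Z x) - 1 - h * Z x))"
      by (intro Bochner_Integration.integral_cong) (auto simp: algebra_simps exp_add)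
    finally have eq: "?F (t + h) - ?F t - h * ?D = expectation (\<lambda>x. exp (t * Z x) * (exp (h * Z x) - 1 - h * Z x))" .
    have bd: "exp (t * Z x) * (exp (h * Z x) - 1 - h * Z x) \<in> {0..h\<^sup>2 * ?C}" if x: "x \<in> space M" for x
    proof -
      have hz: "\<bar>h * Z x\<bar> \<le> K" using tZ[OF x, of h] mult_right_mono[OF h K0] by simp
      have "exp (h * Z x) - 1 - h * Z x \<le> (h * Z x)\<^sup>2 * exp \<bar>h * Z x\<bar>" by (rule exp_minus_linear_bounds)
      also have "\<dots> \<le> (h\<^sup>2 * K\<^sup>2) * exp K"
      proof (intro mult_mono)
        have "(Z x)\<^sup>2 \<le> K\<^sup>2" using K[OF x] K0 by (simp add: abs_le_square_iff[symmetric])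
        then show "(h * Z x)\<^sup>2 \<le> h\<^sup>2 * K\<^sup>2" unfolding power_mult_distrib by (intro mult_left_mono) auto
      qed (use hz in auto)
      finally have "exp (h * Z x) - 1 - h * Z x \<le> h\<^sup>2 * K\<^sup>2 * exp K" .
      then have "exp (t * Z x) * (exp (h * Z x) - 1 - h * Z x) \<le> exp (\<bar>t\<bar> * K) * (h\<^sup>2 * K\<^sup>2 * exp K)"
        using ex[OF x, of t] exp_minus_linear_bounds(1)[of "h * Z x"] by (intro mult_mono) auto
      then show ?thesis using exp_minus_linear_bounds(1)[of "h * Z x"] by (simp add: mult_ac)
    qed
    show ?thesis
      unfolding eq using expectation_in_bounds[OF _ bd] by auto
  qed
  have "((\<lambda>h. (?F (t + h) - ?F t) / h - ?D) \<longlongrightarrow> 0) (at 0)"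
  proof (rule Lim_null_comparison)
    show "\<forall>\<^sub>F h in at 0. norm ((?F (t + h) - ?F t) / h - ?D) \<le> \<bar>h\<bar> * ?C"
      unfolding eventually_at
    proof (intro exI[of _ 1] conjI ballI impI)
      fix h :: real assume h: "h \<noteq> 0 \<and> dist h 0 < 1"
      then have "(?F (t + h) - ?F t) / h - ?D = (?F (t + h) - ?F t - h * ?D) / h" by (simp add: field_simps)
      then have "norm ((?F (t + h) - ?F t) / h - ?D) = \<bar>?F (t + h) - ?F t - h * ?D\<bar> / \<bar>h\<bar>" by simp
      also have "\<dots> \<le> (h\<^sup>2 * ?C) / \<bar>h\<bar>" using est[of h] h by (intro divide_right_mono) auto
      also have "\<dots> = \<bar>h\<bar> * ?C"
        using h by (simp add: power2_eq_square abs_if field_simps)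
      finally show "norm ((?F (t + h) - ?F t) / h - ?D) \<le> \<bar>h\<bar> * ?C" .
    qed simp
    show "((\<lambda>h. \<bar>h\<bar> * ?C) \<longlongrightarrow> 0) (at 0)"
      by (intro tendsto_mult_left_zero tendsto_rabs_zero tendsto_ident_at)
  qed
  then show ?thesis
    unfolding DERIV_def by (rule LIM_zero_cancel)
qed

text \<open>With \<open>a t = exp t - 1 - t / 2\<close> the hypothesis says exactly that \<open>(ln (F t) + s * t / 2) / a t\<close> is
  nonincreasing; its limit at \<open>0\<close> is \<open>2 * F' 0 + s\<close>.\<close>

lemma log_mgf_bound_of_entropy_bound:
  fixes F F' :: "real \<Rightarrow> real" and s :: real
  assumes F: "\<And>t. (F has_real_derivative F' t) (at t)" and pos: "\<And>t. F t > 0" and F0: "F 0 = 1"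
    and ineq: "\<And>t. t > 0 \<Longrightarrow> t * F' t - F t * ln (F t)
      \<le> (t - (exp t - 1 - t / 2) / (exp t - 1 / 2)) * (F' t + s / 2 * F t)"
    and t: "t > 0"
  shows "ln (F t) \<le> t * F' 0 + (2 * F' 0 + s) * (exp t - 1 - t)"
proof -
  define a where "a = (\<lambda>t::real. exp t - 1 - t / 2)"
  define Q where "Q = (\<lambda>t. (ln (F t) + s / 2 * t) / a t)"
  have el: "exp t > 1 + t / 2" if "t > 0" for t :: real using exp_ge_add_one_self[of t] that by linarith
  have apos: "a t > 0" if "t > 0" for t using el[OF that] by (simp add: a_def)
  have dL: "((\<lambda>t. ln (F t)) has_real_derivative F' t / F t) (at t)" for t
    using F[of t] pos[of t] by (auto intro!: derivative_eq_intros)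
  have da: "(a has_real_derivative exp t - 1 / 2) (at t)" for t
    unfolding a_def by (auto intro!: derivative_eq_intros)
  have dQ: "(Q has_real_derivative ((F' t / F t + s / 2) * a t - (ln (F t) + s / 2 * t) * (exp t - 1 / 2)) / (a t * a t)) (at t)"
    if "t > 0" for t
    unfolding Q_def using apos[OF that]
    by (intro DERIV_divide da) (auto intro!: derivative_eq_intros pos F)
  have dQneg: "((F' t / F t + s / 2) * a t - (ln (F t) + s / 2 * t) * (exp t - 1 / 2)) / (a t * a t) \<le> 0"
    if t: "t > 0" for t
  proof -
    define e where "e = exp t - 1 / 2"
    have e: "e > 0" using el[OF t] t by (simp add: e_def)
    define L where "L = ln (F t)"
    define L1 where "L1 = F' t / F t"
    have F1: "F' t = L1 * F t" using pos[of t] by (simp add: L1_def)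
    have "t * F' t - F t * L \<le> (t - a t / e) * (F' t + s / 2 * F t)"
      using ineq[OF t] unfolding L_def e_def a_def .
    moreover have "t * F' t - F t * L = (t * L1 - L) * F t" "F' t + s / 2 * F t = (L1 + s / 2) * F t"
      unfolding F1 by (simp_all add: algebra_simps)
    ultimately have "(t * L1 - L) * F t \<le> ((t - a t / e) * (L1 + s / 2)) * F t"
      by (simp only: mult.assoc)
    then have "t * L1 - L \<le> (t - a t / e) * (L1 + s / 2)" using pos[of t] by simp
    then have "e * (t * L1 - L) \<le> e * ((t - a t / e) * (L1 + s / 2))" using e by (intro mult_left_mono) auto
    also have "\<dots> = (e * t - a t) * (L1 + s / 2)" using e by (simp add: field_simps)
    finally have "(L1 + s / 2) * a t - (L + s / 2 * t) * e \<le> 0" by (simp add: algebra_simps)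
    then show ?thesis unfolding L_def L1_def e_def by (intro divide_nonpos_nonneg) auto
  qed
  have mono: "Q t \<le> Q e" if "0 < e" "e \<le> t" for e
    using that by (intro DERIV_nonpos_imp_nonincreasing[of e t Q]) (auto intro!: exI dQ dQneg)
  \<comment> \<open>Numerator and denominator of \<open>Q\<close> both vanish at 0, so each is
    divided by t and becomes a difference quotient. The derivative 1/2 of \<open>a\<close> at 0 is
    the origin of the factor 2 before the mean in Bousquet's variance term.\<close>
  have lim: "(Q \<longlongrightarrow> (F' 0 + s / 2) / (1 / 2)) (at_right 0)"
  proof -
    have "((\<lambda>t. ln (F t) / t) \<longlongrightarrow> F' 0) (at 0)"
      using dL[of 0] unfolding DERIV_def by (simp add: F0)
    then have 1: "((\<lambda>t. ln (F t) / t) \<longlongrightarrow> F' 0) (at_right 0)"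
      by (rule filterlim_mono) (auto simp: at_le)
    have "((\<lambda>t. a t / t) \<longlongrightarrow> 1 / 2) (at 0)"
      using da[of 0] unfolding DERIV_def by (simp add: a_def)
    then have 2: "((\<lambda>t. a t / t) \<longlongrightarrow> 1 / 2) (at_right 0)"
      by (rule filterlim_mono) (auto simp: at_le)
    have "((\<lambda>t. (ln (F t) / t + s / 2) / (a t / t)) \<longlongrightarrow> (F' 0 + s / 2) / (1 / 2)) (at_right 0)"
      by (intro tendsto_intros 1 2) auto
    moreover have "\<forall>\<^sub>F t in at_right 0. (ln (F t) / t + s / 2) / (a t / t) = Q t"
      unfolding eventually_at_right_field
    proof (intro exI[of _ 1] conjI allI impI)
      fix y :: real assume "0 < y" "y < 1"
      then show "(ln (F y) / y + s / 2) / (a y / y) = Q y"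
        using apos[of y] by (simp add: Q_def field_simps)
    qed simp
    ultimately show ?thesis by (rule Lim_transform_eventually)
  qed
  have "Q t \<le> (F' 0 + s / 2) / (1 / 2)"
  proof (rule tendsto_lowerbound[OF lim])
    show "\<forall>\<^sub>F e in at_right 0. Q t \<le> Q e"
      unfolding eventually_at_right_field using t mono by (intro exI[of _ t]) auto
  qed simp
  \<comment> \<open>As \<open>a t\<close> is \<open>exp t - 1 - t\<close> plus t/2, the linear terms
    in \<open>s\<close> cancel and \<open>t * F' 0\<close> is left over.\<close>
  then have "ln (F t) + s / 2 * t \<le> (2 * F' 0 + s) * a t"
    unfolding Q_def using apos[OF t] by (simp add: field_simps)
  then show ?thesis unfolding a_def by (simp add: algebra_simps)
qed

lemma exp_mult_in_bounds:
  fixes t v n :: real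
  assumes "\<bar>v\<bar> \<le> n"
  shows "exp (t * v) \<in> {exp (- (\<bar>t\<bar> * n))..exp (\<bar>t\<bar> * n)}"
proof -
  have "\<bar>t * v\<bar> \<le> \<bar>t\<bar> * n" unfolding abs_mult using assms by (intro mult_left_mono) auto
  then show ?thesis unfolding atLeastAtMost_iff exp_le_cancel_iff by linarith
qed

lemma (in prob_space) mgf_pos:
  fixes Z :: "'a \<Rightarrow> real"
  assumes [measurable]: "Z \<in> borel_measurable M" and K: "\<And>x. x \<in> space M \<Longrightarrow> \<bar>Z x\<bar> \<le> K"
  shows "0 < expectation (\<lambda>x. exp (t * Z x))"
proof -
  have "expectation (\<lambda>x. exp (t * Z x)) \<in> {exp (- (\<bar>t\<bar> * K))..exp (\<bar>t\<bar> * K)}"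
    by (intro expectation_in_bounds exp_mult_in_bounds K) measurable
  then show ?thesis by (auto intro: less_le_trans[OF exp_gt_zero])
qed

section \<open>Bousquet's inequality for finite classes\<close>

text \<open>The coordinate set \<open>J\<close> is a parameter because the entropy method compares
  the supremum over all coordinates with the one that omits a single coordinate, at the same point
  \<open>x\<close>.\<close>

definition supsum :: "('a \<Rightarrow> real) set \<Rightarrow> 'i set \<Rightarrow> ('i \<Rightarrow> 'a) \<Rightarrow> real" where
  "supsum S J x = Max ((\<lambda>h. \<Sum>j\<in>J. h (x j)) ` S)"

locale finite_centered_class = prob_space M for M :: "'a measure" +
  fixes S :: "('a \<Rightarrow> real) set" and s2 :: real
  assumes finite: "finite S" and nonempty: "S \<noteq> {}"
    and meas [measurable (raw)]: "\<And>h. h \<in> S \<Longrightarrow> h \<in> borel_measurable M"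
    and bound: "\<And>h z. h \<in> S \<Longrightarrow> z \<in> space M \<Longrightarrow> \<bar>h z\<bar> \<le> 1"
    and mean: "\<And>h. h \<in> S \<Longrightarrow> expectation h = 0"
    and variance: "\<And>h. h \<in> S \<Longrightarrow> expectation (\<lambda>z. (h z)\<^sup>2) \<le> s2"
begin

section \<open>Suprema of sums and their increments in one coordinate\<close>

lemma supsum_ge: "h \<in> S \<Longrightarrow> (\<Sum>j\<in>J. h (x j)) \<le> supsum S J x"
  unfolding supsum_def using finite by (intro Max_ge) auto

lemma supsum_attained: "\<exists>h\<in>S. supsum S J x = (\<Sum>j\<in>J. h (x j))"
proof -
  have "supsum S J x \<in> (\<lambda>h. \<Sum>j\<in>J. h (x j)) ` S"
    unfolding supsum_def using finite nonempty by (intro Max_in) auto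
  then show ?thesis by auto
qed

lemma supsum_measurable [measurable]:
  assumes "J \<subseteq> I"
  shows "supsum S J \<in> borel_measurable (PiM I (\<lambda>_. M))"
proof -
  have "(\<lambda>x. \<Sum>j\<in>J. h (x j)) \<in> borel_measurable (PiM I (\<lambda>_. M))" if "h \<in> S" for h
    using assms that
    by (intro borel_measurable_sum measurable_compose[OF measurable_component_singleton _, where g = h] meas) auto
  then show ?thesis
    unfolding supsum_def[abs_def] using finite by (intro borel_measurable_Max) auto
qed

lemma supsum_abs_le:
  assumes "J \<subseteq> I" "x \<in> space (PiM I (\<lambda>_. M))"
  shows "\<bar>supsum S J x\<bar> \<le> card J"
proof -
  obtain h where h: "h \<in> S" "supsum S J x = (\<Sum>j\<in>J. h (x j))" using supsum_attained by blast
  have "\<bar>\<Sum>j\<in>J. h (x j)\<bar> \<le> (\<Sum>j\<in>J. \<bar>h (x j)\<bar>)" by (rule sum_abs)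
  also have "\<dots> \<le> (\<Sum>j\<in>J. 1)"
    using assms h by (intro sum_mono bound) (auto simp: space_PiM PiE_def)
  finally show ?thesis using h by simp
qed

lemma supsum_fun_upd: "i \<notin> J \<Longrightarrow> supsum S J (x(i := y)) = supsum S J x"
  unfolding supsum_def by (intro arg_cong[where f = Max] image_cong sum.cong) auto

text \<open>The maximizer for the larger coordinate set still competes on \<open>J\<close> and loses
  one summand. With the next lemma this supplies \<open>Y \<le> D\<close> and
  \<open>D \<le> 1\<close> for \<open>bousquet_pointwise\<close>, where \<open>D\<close> is the
  increment and \<open>Y\<close> is \<open>h y\<close>.\<close>

lemma supsum_insert_le:
  assumes "finite J" "i \<notin> J" "y \<in> space M"
  shows "supsum S (insert i J) (x(i := y)) - supsum S J x \<le> 1"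
proof -
  obtain h where h: "h \<in> S" "supsum S (insert i J) (x(i := y)) = (\<Sum>j\<in>insert i J. h ((x(i := y)) j))"
    using supsum_attained by blast
  have "(\<Sum>j\<in>J. h ((x(i := y)) j)) = (\<Sum>j\<in>J. h (x j))" using assms by (intro sum.cong) auto
  then show ?thesis
    using assms h supsum_ge[OF h(1), of x J] bound[OF h(1) assms(3)] by simp
qed

lemma supsum_insert_ge:
  assumes "finite J" "i \<notin> J" "h \<in> S" "supsum S J x = (\<Sum>j\<in>J. h (x j))"
  shows "h y \<le> supsum S (insert i J) (x(i := y)) - supsum S J x"
proof -
  have "(\<Sum>j\<in>J. h ((x(i := y)) j)) = (\<Sum>j\<in>J. h (x j))" using assms by (intro sum.cong) auto
  then show ?thesis
    using assms supsum_ge[OF assms(3), of "x(i := y)" "insert i J"] by simp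
qed

text \<open>The self-bounding property: the maximizer for all of \<open>I\<close> competes in every
  supremum with one coordinate omitted, so the increment at \<open>i\<close> is at most its own
  summand \<open>h (x i)\<close>.\<close>

lemma sum_supsum_diff_le:
  assumes "finite I"
  shows "(\<Sum>i\<in>I. supsum S I x - supsum S (I - {i}) x) \<le> supsum S I x"
proof -
  obtain h where h: "h \<in> S" "supsum S I x = (\<Sum>j\<in>I. h (x j))" using supsum_attained by blast
  have "supsum S I x - supsum S (I - {i}) x \<le> h (x i)" if "i \<in> I" for i
    using h(2) supsum_ge[OF h(1), of x "I - {i}"] assms that by (simp add: sum.remove)
  then have "(\<Sum>i\<in>I. supsum S I x - supsum S (I - {i}) x) \<le> (\<Sum>i\<in>I. h (x i))" by (intro sum_mono)
  then show ?thesis using h by simp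
qed

text \<open>The maximizer \<open>h\<close> for the remaining coordinates does not depend on the integrated coordinate, so \<open>h y\<close>
  is centered; as the other coordinates are frozen, no measurable selection is needed.\<close>

lemma coordinate_entropy_le:
  assumes J: "finite J" "i \<notin> J" and x: "x \<in> space (PiM J (\<lambda>_. M))" and l: "l > 0"
  defines "c \<equiv> l - (exp l - 1 - l / 2) / (exp l - 1 / 2)"
    and "Z \<equiv> \<lambda>y. supsum S (insert i J) (x(i := y))" and "Z0 \<equiv> supsum S J x"
  shows "expectation (\<lambda>y. exp (l * Z y) * (l * Z y - l * Z0) - exp (l * Z y) + exp (l * Z0))
    \<le> expectation (\<lambda>y. c * ((Z y - Z0) * exp (l * Z y) + s2 / 2 * exp (l * Z y)))"
proof -
  obtain h where h: "h \<in> S" "supsum S J x = (\<Sum>j\<in>J. h (x j))" using supsum_attained by blast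
  have hm [measurable]: "h \<in> borel_measurable M" using meas h by simp
  have Zm [measurable]: "Z \<in> borel_measurable M"
    unfolding Z_def by (intro measurable_fun_upd_section'[OF _ x] supsum_measurable) auto
  have hZ: "h y \<le> Z y - Z0" for y
    unfolding Z_def Z0_def by (rule supsum_insert_ge[OF J h])
  have Z1: "Z y - Z0 \<le> 1" if "y \<in> space M" for y
    unfolding Z_def Z0_def by (rule supsum_insert_le[OF J that])
  have Zd: "\<bar>Z y - Z0\<bar> \<le> 1" if "y \<in> space M" for y
    using hZ[of y] Z1[OF that] bound[OF h(1) that] by auto
  have eZ: "exp (l * Z y) \<le> exp (l * (Z0 + 1))" if "y \<in> space M" for y
    using Z1[OF that] l by auto
  have i1: "integrable M (\<lambda>y. exp (l * Z y))"
    using eZ by (intro integrable_of_bounded[where K = "exp (l * (Z0 + 1))"]) auto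
  have i2: "integrable M (\<lambda>y. (Z y - Z0) * exp (l * Z y))"
  proof (rule integrable_of_bounded[where K = "1 * exp (l * (Z0 + 1))"])
    fix y assume "y \<in> space M"
    then show "\<bar>(Z y - Z0) * exp (l * Z y)\<bar> \<le> 1 * exp (l * (Z0 + 1))"
      unfolding abs_mult abs_exp_cancel using Zd eZ by (intro mult_mono) auto
  qed measurable
  have i3: "integrable M h" using bound[OF h(1)] by (intro integrable_of_bounded[where K = 1]) auto
  have i4: "integrable M (\<lambda>y. (h y)\<^sup>2)"
    using bound[OF h(1)] by (intro integrable_of_bounded[where K = 1]) (auto simp: abs_square_le_1)
  have c: "c \<ge> 0" using bousquet_pointwise(2)[OF l order_refl, of 1] unfolding c_def by simp
  have i5: "integrable M (\<lambda>y. exp (l * Z y) * (l * Z y - l * Z0) - exp (l * Z y) + exp (l * Z0))"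
  proof -
    have "(\<lambda>y. exp (l * Z y) * (l * Z y - l * Z0)) = (\<lambda>y. l * ((Z y - Z0) * exp (l * Z y)))"
      by (auto simp: algebra_simps)
    then show ?thesis using i1 i2 by (auto intro!: Bochner_Integration.integrable_add Bochner_Integration.integrable_diff)
  qed
  \<comment> \<open>\<open>bousquet_pointwise\<close> multiplied by \<open>exp (l * Z0)\<close>. On
    the right, \<open>h y\<close> will integrate to 0 and its square to at most
    \<open>s2\<close>.\<close>
  have "expectation (\<lambda>y. exp (l * Z y) * (l * Z y - l * Z0) - exp (l * Z y) + exp (l * Z0))
    \<le> expectation (\<lambda>y. c * ((Z y - Z0) * exp (l * Z y)) + c * (exp (l * Z0) / 2) * (h y)\<^sup>2 - c * exp (l * Z0) * h y)"
  proof (intro integral_mono i5)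
    fix y assume y: "y \<in> space M"
    define D where "D = Z y - Z0"
    have Zy: "Z y = Z0 + D" by (simp add: D_def)
    have e: "exp (l * Z y) = exp (l * Z0) * exp (l * D)" by (simp add: Zy distrib_left exp_add)
    have "1 - exp (l * D) + l * D * exp (l * D) \<le> c * (D * exp (l * D) + (h y)\<^sup>2 / 2 - h y)"
      unfolding c_def D_def by (rule bousquet_pointwise(1)[OF l Z1[OF y] hZ])
    then have "exp (l * Z0) * (1 - exp (l * D) + l * D * exp (l * D)) \<le> exp (l * Z0) * (c * (D * exp (l * D) + (h y)\<^sup>2 / 2 - h y))"
      by (intro mult_left_mono) auto
    moreover have "exp (l * Z y) * (l * Z y - l * Z0) - exp (l * Z y) + exp (l * Z0)
        = exp (l * Z0) * (1 - exp (l * D) + l * D * exp (l * D))"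
      unfolding e by (simp add: Zy algebra_simps)
    moreover have "c * ((Z y - Z0) * exp (l * Z y)) + c * (exp (l * Z0) / 2) * (h y)\<^sup>2 - c * exp (l * Z0) * h y
        = exp (l * Z0) * (c * (D * exp (l * D) + (h y)\<^sup>2 / 2 - h y))"
      unfolding e by (simp add: D_def algebra_simps)
    ultimately show "exp (l * Z y) * (l * Z y - l * Z0) - exp (l * Z y) + exp (l * Z0)
      \<le> c * ((Z y - Z0) * exp (l * Z y)) + c * (exp (l * Z0) / 2) * (h y)\<^sup>2 - c * exp (l * Z0) * h y"
      by simp
  qed (use i2 i3 i4 in auto)
  also have "\<dots> = c * expectation (\<lambda>y. (Z y - Z0) * exp (l * Z y)) + c * (exp (l * Z0) / 2) * expectation (\<lambda>y. (h y)\<^sup>2)"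
    using i2 i3 i4 mean[OF h(1)] by simp
  also have "c * (exp (l * Z0) / 2) * expectation (\<lambda>y. (h y)\<^sup>2) \<le> c * (expectation (\<lambda>y. exp (l * Z y)) / 2) * s2"
  proof (intro mult_mono mult_left_mono divide_right_mono)
    have "exp (l * Z0) = expectation (\<lambda>y. exp (l * Z0) * (1 + l * h y))"
      using i3 mean[OF h(1)] by (simp add: prob_space)
    also have "\<dots> \<le> expectation (\<lambda>y. exp (l * Z y))"
    proof (intro integral_mono i1)
      fix y
      have "1 + l * h y \<le> 1 + l * (Z y - Z0)" using hZ[of y] l by simp
      also have "\<dots> \<le> exp (l * (Z y - Z0))" by simp
      finally have "exp (l * Z0) * (1 + l * h y) \<le> exp (l * Z0) * exp (l * (Z y - Z0))" by simp
      then show "exp (l * Z0) * (1 + l * h y) \<le> exp (l * Z y)" by (simp add: algebra_simps flip: exp_add)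
    qed (use i3 in auto)
    finally show "exp (l * Z0) \<le> expectation (\<lambda>y. exp (l * Z y))" .
    show "expectation (\<lambda>y. (h y)\<^sup>2) \<le> s2" by (rule variance[OF h(1)])
    show "0 \<le> c * (expectation (\<lambda>y. exp (l * Z y)) / 2)" using c by simp
  qed (use c in auto)
  also have "c * expectation (\<lambda>y. (Z y - Z0) * exp (l * Z y)) + c * (expectation (\<lambda>y. exp (l * Z y)) / 2) * s2
      = expectation (\<lambda>y. c * ((Z y - Z0) * exp (l * Z y) + s2 / 2 * exp (l * Z y)))"
    using i1 i2 by (simp add: distrib_left)
  finally show ?thesis by simp
qed

text \<open>The sum of the one-coordinate bounds closes up: self-boundedness collapses all
  increments into the supremum itself, which leaves a differential inequality in the moment
  generating function alone.\<close>

lemma entropy_bound: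
  assumes I: "finite I" and l: "l > 0"
  defines "Q \<equiv> PiM I (\<lambda>_. M)"
  shows "l * (\<integral>x. supsum S I x * exp (l * supsum S I x) \<partial>Q)
      - (\<integral>x. exp (l * supsum S I x) \<partial>Q) * ln (\<integral>x. exp (l * supsum S I x) \<partial>Q)
    \<le> (l - (exp l - 1 - l / 2) / (exp l - 1 / 2)) * ((\<integral>x. supsum S I x * exp (l * supsum S I x) \<partial>Q)
       + (card I * s2) / 2 * (\<integral>x. exp (l * supsum S I x) \<partial>Q))"
proof -
  interpret Q: prob_space Q unfolding Q_def by (intro prob_space_PiM prob_space_axioms)
  interpret PS: product_sigma_finite "\<lambda>_::'b. M" by standard
  define c where "c = l - (exp l - 1 - l / 2) / (exp l - 1 / 2)"
  have c: "c \<ge> 0" using bousquet_pointwise(2)[OF l order_refl, of 1] unfolding c_def by simp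
  let ?Z = "supsum S I" and ?n = "real (card I)"
  \<comment> \<open>Omitting coordinate \<open>i\<close> makes \<open>u i\<close> independent of it,
    as tensorization demands.\<close>
  define u where "u = (\<lambda>i x. exp (l * supsum S (I - {i}) x))"
  have Zm [measurable]: "?Z \<in> borel_measurable Q" unfolding Q_def by (intro supsum_measurable) auto
  have Zim [measurable]: "supsum S (I - {i}) \<in> borel_measurable Q" for i
    unfolding Q_def by (intro supsum_measurable) auto
  have Zb: "\<bar>?Z x\<bar> \<le> ?n" if "x \<in> space Q" for x
    using supsum_abs_le[of I I x] that unfolding Q_def by simp
  have Zib: "\<bar>supsum S (I - {i}) x\<bar> \<le> ?n" if "x \<in> space Q" for i x
  proof -
    have "\<bar>supsum S (I - {i}) x\<bar> \<le> card (I - {i})"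
      using supsum_abs_le[of "I - {i}" I x] that unfolding Q_def by auto
    also have "\<dots> \<le> card I" using card_mono[OF I, of "I - {i}"] by auto
    finally show ?thesis by simp
  qed
  have ebd: "exp (l * v) \<in> {exp (- (l * ?n))..exp (l * ?n)}" if "\<bar>v\<bar> \<le> ?n" for v
    using exp_mult_in_bounds[OF that, of l] l by simp
  have g_int: "integrable Q (\<lambda>x. v x * exp (l * ?Z x))" if [measurable]: "v \<in> borel_measurable Q"
    and "\<And>x. x \<in> space Q \<Longrightarrow> \<bar>v x\<bar> \<le> K" for v K
  proof (rule Q.integrable_of_bounded[where K = "K * exp (l * ?n)"])
    fix x assume x: "x \<in> space Q"
    then show "\<bar>v x * exp (l * ?Z x)\<bar> \<le> K * exp (l * ?n)"
      unfolding abs_mult abs_exp_cancel using that(2)[OF x] ebd[OF Zb[OF x]] by (intro mult_mono) auto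
  qed measurable
  define d where "d = (\<lambda>i x. exp (l * ?Z x) * (l * ?Z x - l * supsum S (I - {i}) x) - exp (l * ?Z x) + exp (l * supsum S (I - {i}) x))"
  define g where "g = (\<lambda>i x. c * ((?Z x - supsum S (I - {i}) x) * exp (l * ?Z x) + s2 / 2 * exp (l * ?Z x)))"
  have [measurable]: "d i \<in> borel_measurable Q" "g i \<in> borel_measurable Q" for i
    unfolding d_def g_def by measurable
  have bd: "\<exists>K. \<forall>x\<in>space Q. \<bar>d i x\<bar> \<le> K" "\<exists>K. \<forall>x\<in>space Q. \<bar>g i x\<bar> \<le> K" for i
  proof -
    let ?E = "exp (l * ?n)"
    have dif: "\<bar>?Z x - supsum S (I - {i}) x\<bar> * exp (l * ?Z x) \<le> (2 * ?n) * ?E" if x: "x \<in> space Q" for x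
      using Zb[OF x] Zib[OF x, of i] ebd[OF Zb[OF x]] by (intro mult_mono) auto
    have "\<bar>d i x\<bar> \<le> l * ((2 * ?n) * ?E) + ?E + ?E" if x: "x \<in> space Q" for x
    proof -
      have "\<bar>d i x\<bar> \<le> \<bar>exp (l * ?Z x) * (l * ?Z x - l * supsum S (I - {i}) x)\<bar> + exp (l * ?Z x) + exp (l * supsum S (I - {i}) x)"
        unfolding d_def by (smt (verit) exp_gt_zero)
      moreover have "\<bar>exp (l * ?Z x) * (l * ?Z x - l * supsum S (I - {i}) x)\<bar> = l * (\<bar>?Z x - supsum S (I - {i}) x\<bar> * exp (l * ?Z x))"
        using l by (simp add: abs_mult mult_ac flip: right_diff_distrib)
      moreover have "\<dots> \<le> l * ((2 * ?n) * ?E)" using l dif[OF x] by simp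
      ultimately show ?thesis using ebd[OF Zb[OF x]] ebd[OF Zib[OF x, of i]]
        unfolding atLeastAtMost_iff by linarith
    qed
    then show "\<exists>K. \<forall>x\<in>space Q. \<bar>d i x\<bar> \<le> K" by blast
    have "\<bar>g i x\<bar> \<le> c * ((2 * ?n) * ?E + \<bar>s2 / 2\<bar> * ?E)" if x: "x \<in> space Q" for x
    proof -
      have "\<bar>g i x\<bar> = c * \<bar>(?Z x - supsum S (I - {i}) x) * exp (l * ?Z x) + s2 / 2 * exp (l * ?Z x)\<bar>"
        unfolding g_def using c by (simp add: abs_mult)
      also have "\<dots> \<le> c * (\<bar>?Z x - supsum S (I - {i}) x\<bar> * exp (l * ?Z x) + \<bar>s2 / 2\<bar> * exp (l * ?Z x))"
        using c by (intro mult_left_mono order_trans[OF abs_triangle_ineq]) (auto simp: abs_mult)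
      also have "\<dots> \<le> c * ((2 * ?n) * ?E + \<bar>s2 / 2\<bar> * ?E)"
        using c dif[OF x] ebd[OF Zb[OF x]] by (intro mult_left_mono add_mono) auto
      finally show ?thesis .
    qed
    then show "\<exists>K. \<forall>x\<in>space Q. \<bar>g i x\<bar> \<le> K" by blast
  qed
  have gi_int: "integrable Q (g i)" for i
  proof -
    obtain K where "\<forall>x\<in>space Q. \<bar>g i x\<bar> \<le> K" using bd(2) by blast
    then show ?thesis by (intro Q.integrable_of_bounded[where K = K]) auto
  qed
  have coord: "(\<integral>x. d i x \<partial>Q) \<le> (\<integral>x. g i x \<partial>Q)" if i: "i \<in> I" for i
  proof -
    let ?J = "I - {i}"
    have IJ: "I = insert i ?J" using i by auto
    have J: "finite ?J" "i \<notin> ?J" using I by auto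
    have Q_eq: "Q = PiM (insert i ?J) (\<lambda>_. M)" unfolding Q_def using IJ by simp
    have fub: "(\<integral>x. v x \<partial>Q) = (\<integral>x. (\<integral>y. v (x(i := y)) \<partial>M) \<partial>PiM ?J (\<lambda>_. M))"
      "integrable (PiM ?J (\<lambda>_. M)) (\<lambda>x. \<integral>y. v (x(i := y)) \<partial>M)"
      if vm: "v \<in> borel_measurable Q" and vb: "\<exists>K. \<forall>x\<in>space Q. \<bar>v x\<bar> \<le> K" for v :: "_ \<Rightarrow> real"
    proof -
      obtain K where "\<forall>x\<in>space Q. \<bar>v x\<bar> \<le> K" using vb by blast
      then have K: "\<And>x. x \<in> space Q \<Longrightarrow> \<bar>v x\<bar> \<le> K" by blast
      then have "integrable Q v" using vm by (intro Q.integrable_of_bounded)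
      then show "(\<integral>x. v x \<partial>Q) = (\<integral>x. (\<integral>y. v (x(i := y)) \<partial>M) \<partial>PiM ?J (\<lambda>_. M))"
        unfolding Q_eq by (intro PS.product_integral_insert J)
      show "integrable (PiM ?J (\<lambda>_. M)) (\<lambda>x. \<integral>y. v (x(i := y)) \<partial>M)"
        using vm K unfolding Q_eq
        by (intro integrable_section_integral[where lo = "- K" and hi = K]) (auto simp: abs_le_iff minus_le_iff)
    qed
    note mb = \<open>d i \<in> borel_measurable Q\<close> bd(1)[of i] and mg = \<open>g i \<in> borel_measurable Q\<close> bd(2)[of i]
    show ?thesis
      unfolding fub(1)[OF mb] fub(1)[OF mg]
    proof (rule integral_mono[OF fub(2)[OF mb] fub(2)[OF mg]])
      fix x assume x: "x \<in> space (PiM ?J (\<lambda>_. M))"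
      have "supsum S ?J (x(i := y)) = supsum S ?J x" for y by (rule supsum_fun_upd) auto
      then show "(\<integral>y. d i (x(i := y)) \<partial>M) \<le> (\<integral>y. g i (x(i := y)) \<partial>M)"
        using coordinate_entropy_le[OF J x l] IJ unfolding d_def g_def c_def by simp
    qed
  qed
  have "(\<integral>x. exp (l * ?Z x) * ln (exp (l * ?Z x)) \<partial>Q)
      - (\<integral>x. exp (l * ?Z x) \<partial>Q) * ln (\<integral>x. exp (l * ?Z x) \<partial>Q)
    \<le> (\<Sum>i\<in>I. \<integral>x. (exp (l * ?Z x) * (ln (exp (l * ?Z x)) - ln (u i x)) - exp (l * ?Z x) + u i x) \<partial>Q)"
    unfolding Q_def
  proof (rule entropy_tensorization[OF I, where l = "exp (- (l * ?n))" and h = "exp (l * ?n)"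
        and f = "\<lambda>x. exp (l * ?Z x)" and u = u])
    show "u i (x(i := y)) = u i x" for i x y
      unfolding u_def by (simp add: supsum_fun_upd)
  qed (use Zb Zib in \<open>auto intro!: ebd simp del: atLeastAtMost_iff simp: u_def simp flip: Q_def\<close>)
  then have "(\<integral>x. exp (l * ?Z x) * (l * ?Z x) \<partial>Q)
      - (\<integral>x. exp (l * ?Z x) \<partial>Q) * ln (\<integral>x. exp (l * ?Z x) \<partial>Q) \<le> (\<Sum>i\<in>I. \<integral>x. d i x \<partial>Q)"
    by (simp add: u_def d_def)
  also have "\<dots> \<le> (\<Sum>i\<in>I. \<integral>x. g i x \<partial>Q)" by (intro sum_mono coord)
  also have "\<dots> = (\<integral>x. (\<Sum>i\<in>I. g i x) \<partial>Q)"
    by (rule Bochner_Integration.integral_sum[symmetric]) (rule gi_int)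
  \<comment> \<open>Self-boundedness enters here; the sign of \<open>c\<close> and the positivity of
    the exponential preserve the direction.\<close>
  also have "\<dots> \<le> (\<integral>x. c * (?Z x * exp (l * ?Z x) + (?n * s2) / 2 * exp (l * ?Z x)) \<partial>Q)"
  proof (rule integral_mono)
    show "integrable Q (\<lambda>x. \<Sum>i\<in>I. g i x)"
      by (intro Bochner_Integration.integrable_sum gi_int)
    show "integrable Q (\<lambda>x. c * (?Z x * exp (l * ?Z x) + (?n * s2) / 2 * exp (l * ?Z x)))"
      using g_int[of ?Z ?n] g_int[of "\<lambda>_. 1" 1] Zb
      by (intro integrable_mult_right Bochner_Integration.integrable_add) auto
    fix x
    have "(\<Sum>i\<in>I. g i x) = c * ((\<Sum>i\<in>I. ?Z x - supsum S (I - {i}) x) * exp (l * ?Z x) + (?n * s2) / 2 * exp (l * ?Z x))"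
      unfolding g_def by (simp add: sum_distrib_left[symmetric] sum_distrib_right sum.distrib)
    also have "\<dots> \<le> c * (?Z x * exp (l * ?Z x) + (?n * s2) / 2 * exp (l * ?Z x))"
      using c sum_supsum_diff_le[OF I, of x] by (intro mult_left_mono add_right_mono mult_right_mono) auto
    finally show "(\<Sum>i\<in>I. g i x) \<le> c * (?Z x * exp (l * ?Z x) + (?n * s2) / 2 * exp (l * ?Z x))" .
  qed
  also have "\<dots> = c * ((\<integral>x. ?Z x * exp (l * ?Z x) \<partial>Q) + (?n * s2) / 2 * (\<integral>x. exp (l * ?Z x) \<partial>Q))"
    using g_int[of ?Z ?n] g_int[of "\<lambda>_. 1" 1] Zb by simp
  finally show ?thesis
    unfolding c_def[symmetric] by (simp add: mult_ac)
qed

lemma bousquet_log_mgf: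
  assumes I: "finite I" and l: "l > 0"
  defines "Q \<equiv> PiM I (\<lambda>_. M)"
  shows "ln (\<integral>x. exp (l * supsum S I x) \<partial>Q)
    \<le> l * (\<integral>x. supsum S I x \<partial>Q) + (2 * (\<integral>x. supsum S I x \<partial>Q) + card I * s2) * (exp l - 1 - l)"
proof -
  interpret Q: prob_space Q unfolding Q_def by (intro prob_space_PiM prob_space_axioms)
  have Zm [measurable]: "supsum S I \<in> borel_measurable Q" unfolding Q_def by (intro supsum_measurable) auto
  have Zb: "\<bar>supsum S I x\<bar> \<le> card I" if "x \<in> space Q" for x
    using supsum_abs_le[of I I x] that unfolding Q_def by simp
  \<comment> \<open>The mean enters as the derivative of the moment generating function at 0, hence
    the factor with exponent \<open>0 * supsum S I x\<close>.\<close>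
  have "ln (\<integral>x. exp (l * supsum S I x) \<partial>Q)
    \<le> l * (\<integral>x. supsum S I x * exp (0 * supsum S I x) \<partial>Q)
     + (2 * (\<integral>x. supsum S I x * exp (0 * supsum S I x) \<partial>Q) + card I * s2) * (exp l - 1 - l)"
  proof (rule log_mgf_bound_of_entropy_bound[where F' = "\<lambda>t. \<integral>x. supsum S I x * exp (t * supsum S I x) \<partial>Q", OF _ _ _ _ l])
    show "((\<lambda>t. \<integral>x. exp (t * supsum S I x) \<partial>Q) has_real_derivative (\<integral>x. supsum S I x * exp (t * supsum S I x) \<partial>Q)) (at t)" for t
      by (rule Q.has_real_derivative_mgf[OF Zm Zb])
    show "(\<integral>x. exp (t * supsum S I x) \<partial>Q) > 0" for t
      by (rule Q.mgf_pos[OF Zm Zb])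
    show "t > 0 \<Longrightarrow> t * (\<integral>x. supsum S I x * exp (t * supsum S I x) \<partial>Q)
      - (\<integral>x. exp (t * supsum S I x) \<partial>Q) * ln (\<integral>x. exp (t * supsum S I x) \<partial>Q)
      \<le> (t - (exp t - 1 - t / 2) / (exp t - 1 / 2)) * ((\<integral>x. supsum S I x * exp (t * supsum S I x) \<partial>Q)
       + (card I * s2) / 2 * (\<integral>x. exp (t * supsum S I x) \<partial>Q))" for t
      unfolding Q_def by (rule entropy_bound[OF I])
  qed (simp add: Q.prob_space)
  then show ?thesis by simp
qed

text \<open>Chernoff's bound at the parameter from \<open>chernoff_parameter_exists\<close>.
  Allowing any upper bound \<open>E\<close> for the mean lets one threshold serve all finite
  subclasses of an infinite class.\<close>

lemma bousquet_tail:
  assumes I: "finite I" and x: "0 < x" and s2: "0 \<le> s2" and E: "0 \<le> E"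
  defines "Q \<equiv> PiM I (\<lambda>_. M)"
  assumes mean_le: "(\<integral>T. supsum S I T \<partial>Q) \<le> E"
    and t: "3 * E + sqrt (2 * x * (card I * s2)) + 5 * x / 6 \<le> t"
  shows "measure Q {T \<in> space Q. t \<le> supsum S I T} \<le> exp (- x)"
proof -
  interpret Q: prob_space Q unfolding Q_def by (intro prob_space_PiM prob_space_axioms)
  let ?Z = "supsum S I" and ?s = "card I * s2"
  obtain l where l: "l > 0" "l * E + (2 * E + ?s) * (exp l - 1 - l) - l * t \<le> - x"
    using chernoff_parameter_exists[OF E _ x t] s2 by auto
  have Zm [measurable]: "?Z \<in> borel_measurable Q" unfolding Q_def by (intro supsum_measurable) auto
  have Zb: "\<bar>?Z T\<bar> \<le> card I" if "T \<in> space Q" for T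
    using supsum_abs_le[of I I T] that unfolding Q_def by simp
  have eb: "exp (l * ?Z T) \<in> {exp (- (l * card I))..exp (l * card I)}" if "T \<in> space Q" for T
    using exp_mult_in_bounds[OF Zb[OF that], of l] l by simp
  have int: "integrable Q (\<lambda>T. exp (l * ?Z T))"
    using eb by (intro Q.integrable_of_bounded[where K = "exp (l * card I)"]) auto
  have pos: "(\<integral>T. exp (l * ?Z T) \<partial>Q) > 0"
    by (rule Q.mgf_pos[OF Zm Zb])
  have "ln (\<integral>T. exp (l * ?Z T) \<partial>Q) \<le> l * (\<integral>T. ?Z T \<partial>Q) + (2 * (\<integral>T. ?Z T \<partial>Q) + ?s) * (exp l - 1 - l)"
    unfolding Q_def by (rule bousquet_log_mgf[OF I l(1)])
  also have "\<dots> \<le> l * E + (2 * E + ?s) * (exp l - 1 - l)"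
  proof (intro add_mono mult_left_mono mult_right_mono)
    show "0 \<le> exp l - 1 - l" by (rule exp_minus_linear_bounds(1))
  qed (use l mean_le in auto)
  finally have "exp (ln (\<integral>T. exp (l * ?Z T) \<partial>Q)) \<le> exp (l * E + (2 * E + ?s) * (exp l - 1 - l))"
    by (simp only: exp_le_cancel_iff)
  then have mgf: "(\<integral>T. exp (l * ?Z T) \<partial>Q) \<le> exp (l * E + (2 * E + ?s) * (exp l - 1 - l))"
    using pos by simp
  have "measure Q {T \<in> space Q. ?Z T \<ge> t} \<le> exp (- l * t) * (\<integral>T\<in>space Q. exp (l * ?Z T) \<partial>Q)"
  proof (intro Q.Chernoff_ineq_ge l)
    show "set_integrable Q (space Q) (\<lambda>T. exp (l * ?Z T))"
      unfolding set_integrable_def by (intro integrable_mult_indicator int) auto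
  qed auto
  also have "(\<integral>T\<in>space Q. exp (l * ?Z T) \<partial>Q) = (\<integral>T. exp (l * ?Z T) \<partial>Q)"
    by (rule set_integral_space[OF int])
  also have "exp (- l * t) * \<dots> \<le> exp (- l * t) * exp (l * E + (2 * E + ?s) * (exp l - 1 - l))"
    using mgf by (intro mult_left_mono) auto
  also have "\<dots> \<le> exp (- x)" using l(2) by (simp flip: exp_add)
  finally show ?thesis .
qed

end

section \<open>Separable classes and the oracle inequality\<close>

text \<open>A countable dense subset of \<open>G\<close> may miss \<open>H\<close> altogether. So
  for each of its points and each radius 1/(k+1) a member of \<open>H\<close> within that radius is
  chosen, whenever there is one.\<close>

lemma sup_separable_subset:
  assumes G: "sup_separable Z G" and H: "H \<subseteq> G"
  shows "sup_separable Z H"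
proof -
  obtain D where D: "countable D" "D \<subseteq> G" "\<And>g e. g \<in> G \<Longrightarrow> e > 0 \<Longrightarrow> \<exists>d\<in>D. \<forall>z\<in>Z. \<bar>g z - d z\<bar> \<le> e"
    using G unfolding sup_separable_def by blast
  define near where "near = (\<lambda>(d, k::nat) h. h \<in> H \<and> (\<forall>z\<in>Z. \<bar>h z - d z\<bar> \<le> inverse (Suc k)))"
  define pick where "pick = (\<lambda>p. SOME h. near p h)"
  define D' where "D' = pick ` {p \<in> D \<times> UNIV. \<exists>h. near p h}"
  have pick: "near p (pick p)" if "near p h" for p h
    unfolding pick_def by (rule someI[of "near p", OF that])
  have "countable D'"
    unfolding D'_def using D(1) by (intro countable_image countable_Collect countable_SIGMA) auto
  moreover have "D' \<subseteq> H"
    unfolding D'_def using pick by (fastforce simp: near_def split: prod.splits)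
  moreover have "\<exists>d\<in>D'. \<forall>z\<in>Z. \<bar>g z - d z\<bar> \<le> e" if g: "g \<in> H" and e: "e > 0" for g and e :: real
  proof -
    obtain k :: nat where k: "inverse (Suc k) < e / 2"
      using reals_Archimedean[of "e / 2"] e by auto
    obtain d where d: "d \<in> D" "\<forall>z\<in>Z. \<bar>g z - d z\<bar> \<le> inverse (Suc k)"
      using D(3)[of g "inverse (Suc k)"] g H by auto
    then have near: "near (d, k) g" using g by (auto simp: near_def)
    have "pick (d, k) \<in> D'" unfolding D'_def using d near by blast
    moreover have "\<bar>g z - pick (d, k) z\<bar> \<le> e" if "z \<in> Z" for z
    proof -
      have "\<bar>g z - d z\<bar> \<le> inverse (Suc k)" "\<bar>pick (d, k) z - d z\<bar> \<le> inverse (Suc k)"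
        using pick[OF near] near that by (auto simp: near_def)
      then show ?thesis using k by linarith
    qed
    ultimately show ?thesis by blast
  qed
  ultimately show ?thesis unfolding sup_separable_def by blast
qed

text \<open>The event is a union over a possibly uncountable class, so the conclusion provides a
  measurable cover \<open>A\<close> instead of its probability.\<close>

lemma (in prob_space) empirical_sup_tail:
  fixes H :: "('a \<Rightarrow> real) set" and K V x t :: real and n :: nat
  defines "Q \<equiv> PiM {0..<n} (\<lambda>_. M)"
    and "dev \<equiv> \<lambda>g T. expectation g - (\<Sum>i<n. g (T i)) / real n"
  defines "W \<equiv> (\<integral>T. (SUP g\<in>H. \<bar>dev g T\<bar>) \<partial>Q)"
  assumes sep: "sup_separable (space M) H" and ne: "H \<noteq> {}"
    and Hm: "\<And>g. g \<in> H \<Longrightarrow> g \<in> borel_measurable M"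
    and K: "0 < K" and Hb: "\<And>g z. g \<in> H \<Longrightarrow> z \<in> space M \<Longrightarrow> \<bar>g z\<bar> \<le> K"
    and V: "\<And>g. g \<in> H \<Longrightarrow> expectation (\<lambda>z. (g z)\<^sup>2) \<le> V"
    and n: "n \<ge> 1" and x: "0 < x"
    and t: "3 * W + sqrt (2 * x * V / n) + 2 * x * K / n \<le> t"
  shows "\<exists>A\<in>sets Q. measure Q A \<le> exp (- x) \<and> {T \<in> space Q. \<exists>g\<in>H. t \<le> dev g T} \<subseteq> A"
proof -
  interpret Q: prob_space Q unfolding Q_def by (intro prob_space_PiM prob_space_axioms)
  have n0: "real n > 0" using n by simp
  have Hi: "integrable M g" if "g \<in> H" for g
    using Hm[OF that] Hb[OF that] by (rule integrable_of_bounded)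
  have Hi2: "integrable M (\<lambda>z. (g z)\<^sup>2)" if "g \<in> H" for g
  proof (rule integrable_of_bounded)
    show "\<bar>(g z)\<^sup>2\<bar> \<le> K\<^sup>2" if "z \<in> space M" for z
      using Hb[OF \<open>g \<in> H\<close> that] K by (simp add: abs_le_square_iff[symmetric])
  qed (use Hm[OF that] in measurable)
  have EK: "\<bar>expectation g\<bar> \<le> K" if "g \<in> H" for g
  proof -
    have "expectation g \<in> {-K..K}"
      using Hb[OF that] by (intro expectation_in_bounds Hm[OF that]) (auto simp: abs_le_iff minus_le_iff)
    then show ?thesis by auto
  qed
  have Tsp: "T i \<in> space M" if "T \<in> space Q" "i < n" for T i
    using that unfolding Q_def by (auto simp: space_PiM PiE_def)
  have devm [measurable]: "dev g \<in> borel_measurable Q" if g: "g \<in> H" for g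
  proof -
    have "(\<lambda>T. g (T i)) \<in> borel_measurable Q" if "i < n" for i
      unfolding Q_def using that
      by (intro measurable_compose[OF measurable_component_singleton _, where g = g] Hm[OF g]) auto
    then show ?thesis unfolding dev_def by (intro borel_measurable_diff borel_measurable_divide borel_measurable_sum) auto
  qed
  have dev_close: "\<bar>dev g T - dev d T\<bar> \<le> 2 * e"
    if "g \<in> H" "d \<in> H" "T \<in> space Q" and e: "\<forall>z\<in>space M. \<bar>g z - d z\<bar> \<le> e" for g d T e
  proof -
    have "expectation (\<lambda>z. g z - d z) \<in> {-e..e}"
      using e Hm[OF that(1)] Hm[OF that(2)]
      by (intro expectation_in_bounds) (auto simp: abs_le_iff minus_le_iff)
    then have 1: "\<bar>expectation g - expectation d\<bar> \<le> e" using Hi that by auto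
    have "\<bar>\<Sum>i<n. g (T i) - d (T i)\<bar> \<le> (\<Sum>i<n. \<bar>g (T i) - d (T i)\<bar>)" by (rule sum_abs)
    also have "\<dots> \<le> (\<Sum>i<n. e)" using e Tsp[OF that(3)] by (intro sum_mono) auto
    finally have "\<bar>\<Sum>i<n. g (T i) - d (T i)\<bar> / n \<le> e" using n0 by (simp add: field_simps)
    then have 2: "\<bar>(\<Sum>i<n. g (T i)) / n - (\<Sum>i<n. d (T i)) / n\<bar> \<le> e"
      by (simp add: sum_subtractf flip: diff_divide_distrib)
    show ?thesis using 1 2 unfolding dev_def by linarith
  qed
  have dev_bound: "\<bar>dev g T\<bar> \<le> 2 * K" if "g \<in> H" "T \<in> space Q" for g T
  proof -
    have "\<bar>\<Sum>i<n. g (T i)\<bar> \<le> (\<Sum>i<n. \<bar>g (T i)\<bar>)" by (rule sum_abs)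
    also have "\<dots> \<le> (\<Sum>i<n. K)" using Hb[OF that(1)] Tsp[OF that(2)] by (intro sum_mono) auto
    finally have "\<bar>(\<Sum>i<n. g (T i)) / n\<bar> \<le> K" using n0 by (simp add: field_simps)
    then show ?thesis using EK[OF that(1)] unfolding dev_def by linarith
  qed
  obtain D where D: "countable D" "D \<subseteq> H"
    and dense: "\<And>g e. g \<in> H \<Longrightarrow> e > 0 \<Longrightarrow> \<exists>d\<in>D. \<forall>z\<in>space M. \<bar>g z - d z\<bar> \<le> e"
    using sep unfolding sup_separable_def by blast
  have Dne: "D \<noteq> {}" using ne dense[of _ 1] by fastforce
  define R where "R = (\<lambda>T. SUP g\<in>H. \<bar>dev g T\<bar>)"
  have bdd: "bdd_above ((\<lambda>g. \<bar>dev g T\<bar>) ` H')" if "T \<in> space Q" "H' \<subseteq> H" for T H'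
    using dev_bound that by (intro bdd_aboveI2[where M = "2 * K"]) auto
  have R_ge: "\<bar>dev g T\<bar> \<le> R T" if "g \<in> H" "T \<in> space Q" for g T
    unfolding R_def using that bdd by (intro cSUP_upper) auto
  \<comment> \<open>Replacing \<open>H\<close> by the countable \<open>D\<close> makes the supremum
    measurable. Only then is \<open>W\<close> a genuine expectation and not the default value 0 of
    the integral.\<close>
  have R_D: "R T = (SUP g\<in>D. \<bar>dev g T\<bar>)" if T: "T \<in> space Q" for T
  proof (rule antisym)
    show "(SUP g\<in>D. \<bar>dev g T\<bar>) \<le> R T"
      unfolding R_def using T D Dne bdd by (intro cSUP_subset_mono) auto
    show "R T \<le> (SUP g\<in>D. \<bar>dev g T\<bar>)"
      unfolding R_def
    proof (rule cSUP_least[OF ne], rule field_le_epsilon)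
      fix g and e :: real assume g: "g \<in> H" and e: "e > 0"
      then obtain d where d: "d \<in> D" "\<forall>z\<in>space M. \<bar>g z - d z\<bar> \<le> e / 2"
        using dense[of g "e / 2"] by auto
      have "\<bar>dev d T\<bar> \<le> (SUP g\<in>D. \<bar>dev g T\<bar>)" using d D T bdd by (intro cSUP_upper) auto
      then show "\<bar>dev g T\<bar> \<le> (SUP g\<in>D. \<bar>dev g T\<bar>) + e"
        using dev_close[OF g _ T d(2)] d(1) D(2) by auto
    qed
  qed
  have Rm [measurable]: "R \<in> borel_measurable Q"
  proof -
    have "(\<lambda>T. SUP g\<in>D. \<bar>dev g T\<bar>) \<in> borel_measurable Q"
      using D bdd devm by (intro borel_measurable_cSUP borel_measurable_abs) auto
    then show ?thesis using R_D by (subst measurable_cong[of Q R]) auto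
  qed
  have Rb: "R T \<in> {0..2 * K}" if T: "T \<in> space Q" for T
  proof -
    obtain g where "g \<in> H" using ne by auto
    then have "0 \<le> R T" using R_ge[of g T] T by linarith
    moreover have "R T \<le> 2 * K" unfolding R_def using T dev_bound by (intro cSUP_least ne) auto
    ultimately show ?thesis by simp
  qed
  have Rint: "integrable Q R" using Rb by (intro Q.integrable_of_bounded[where K = "2 * K"]) auto
  have W_R: "W = (\<integral>T. R T \<partial>Q)" unfolding W_def R_def ..
  have W0: "0 \<le> W" unfolding W_R using Rb by (intro Bochner_Integration.integral_nonneg) auto
  have V0: "0 \<le> V"
  proof -
    obtain g where g: "g \<in> H" using ne by auto
    have "0 \<le> expectation (\<lambda>z. (g z)\<^sup>2)" by simp
    then show ?thesis using V[OF g] by linarith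
  qed
  \<comment> \<open>The threshold lowered by the slack (2 - 5/3) x K / n, which is reserved for
    approximating \<open>H\<close> by \<open>D\<close>.\<close>
  define t' where "t' = t - x * K / (3 * n)"
  define k where "k = real n / (2 * K)"
  have k: "k > 0" unfolding k_def using K n0 by simp
  have fin: "measure Q {T \<in> space Q. \<exists>g\<in>S. t' \<le> dev g T} \<le> exp (- x)"
    if S: "finite S" "S \<noteq> {}" "S \<subseteq> H" for S
  proof -
    \<comment> \<open>The sign matches \<open>dev\<close>. The mean and the value of
      \<open>g\<close> are both bounded by \<open>K\<close>, so 2K normalizes the difference; the
      variance is at most the second moment, hence \<open>V / (4 * K\<^sup>2)\<close>.\<close>
    define cen where "cen = (\<lambda>g z. (expectation g - g z) / (2 * K))"
    have SH: "g \<in> S \<Longrightarrow> g \<in> H" for g using S by auto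
    interpret C: finite_centered_class M "cen ` S" "V / (4 * K\<^sup>2)"
    proof
      show "finite (cen ` S)" "cen ` S \<noteq> {}" using S by auto
      fix h assume "h \<in> cen ` S"
      then obtain g where g: "g \<in> H" and h: "h = cen g" using SH by auto
      have gm [measurable]: "g \<in> borel_measurable M" by (rule Hm[OF g])
      show "h \<in> borel_measurable M" unfolding h cen_def by measurable
      show "\<bar>h z\<bar> \<le> 1" if "z \<in> space M" for z
        using EK[OF g] Hb[OF g that] K unfolding h cen_def by (simp add: abs_le_iff field_simps)
      show "expectation h = 0" unfolding h cen_def using Hi[OF g] by (simp add: prob_space)
      have "expectation (\<lambda>z. (h z)\<^sup>2) = expectation (\<lambda>z. ((expectation g)\<^sup>2 - 2 * expectation g * g z + (g z)\<^sup>2) / (4 * K\<^sup>2))"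
        unfolding h cen_def
        by (intro Bochner_Integration.integral_cong) (auto simp: power_divide power2_diff power_mult_distrib)
      also have "\<dots> = ((expectation g)\<^sup>2 - 2 * expectation g * expectation g + expectation (\<lambda>z. (g z)\<^sup>2)) / (4 * K\<^sup>2)"
        using Hi[OF g] Hi2[OF g] by (simp add: prob_space)
      also have "\<dots> \<le> V / (4 * K\<^sup>2)"
      proof (rule divide_right_mono)
        have "(expectation g)\<^sup>2 - 2 * expectation g * expectation g \<le> 0" by (simp add: power2_eq_square)
        then show "(expectation g)\<^sup>2 - 2 * expectation g * expectation g + expectation (\<lambda>z. (g z)\<^sup>2) \<le> V"
          using V[OF g] by linarith
      qed simp
      finally show "expectation (\<lambda>z. (h z)\<^sup>2) \<le> V / (4 * K\<^sup>2)" .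
    qed
    have sum_cen: "(\<Sum>j\<in>{0..<n}. cen g (T j)) = k * dev g T" for g T
    proof -
      have "(\<Sum>j\<in>{0..<n}. cen g (T j)) = (n * expectation g - (\<Sum>j<n. g (T j))) / (2 * K)"
        unfolding cen_def by (simp add: sum_divide_distrib[symmetric] sum_subtractf atLeast0LessThan)
      also have "\<dots> = k * dev g T" unfolding k_def dev_def using n0 K by (simp add: field_simps)
      finally show ?thesis .
    qed
    let ?Z = "supsum (cen ` S) {0..<n}"
    have Z_ge: "k * dev g T \<le> ?Z T" if "g \<in> S" for g T
      using C.supsum_ge[of "cen g" T "{0..<n}"] that sum_cen[of g T] by auto
    have Z_le: "?Z T \<le> k * R T" if T: "T \<in> space Q" for T
    proof -
      obtain g where "g \<in> S" "?Z T = k * dev g T"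
        using C.supsum_attained[of "{0..<n}" T] sum_cen by fastforce
      then show ?thesis using R_ge[OF SH T, of g] k by auto
    qed
    have Zm: "?Z \<in> borel_measurable Q" unfolding Q_def by (rule C.supsum_measurable) simp
    have Zint: "integrable Q ?Z"
      using C.supsum_abs_le[of "{0..<n}" "{0..<n}"]
      by (intro Q.integrable_of_bounded[OF Zm, where K = "card {0..<n}"]) (auto simp: Q_def)
    \<comment> \<open>The one-sided maximum over \<open>S\<close> is dominated by the two-sided
      supremum over \<open>H\<close>, uniformly in \<open>S\<close>.\<close>
    have mean: "(\<integral>T. ?Z T \<partial>Q) \<le> k * W"
    proof -
      have "(\<integral>T. ?Z T \<partial>Q) \<le> (\<integral>T. k * R T \<partial>Q)"
        using Z_le Rint Zint by (intro integral_mono) auto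
      then show ?thesis unfolding W_R by simp
    qed
    have "measure Q {T \<in> space Q. k * t' \<le> ?Z T} \<le> exp (- x)"
      unfolding Q_def
    proof (rule C.bousquet_tail[OF _ x])
      show "(\<integral>T. ?Z T \<partial>PiM {0..<n} (\<lambda>_. M)) \<le> k * W" using mean unfolding Q_def .
      have "sqrt (2 * x * (real (card {0..<n}) * (V / (4 * K\<^sup>2)))) = sqrt (k\<^sup>2 * (2 * x * V / n))"
        unfolding k_def using n0 K by (simp add: field_simps power2_eq_square)
      also have "\<dots> = k * sqrt (2 * x * V / n)" unfolding real_sqrt_mult[of "k\<^sup>2"] using k by simp
      finally have "3 * (k * W) + sqrt (2 * x * (real (card {0..<n}) * (V / (4 * K\<^sup>2)))) + 5 * x / 6
        = k * (3 * W + sqrt (2 * x * V / n)) + 5 * x / 6"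
        by (simp add: algebra_simps)
      also have "\<dots> = k * (3 * W + sqrt (2 * x * V / n) + 2 * x * K / n - x * K / (3 * n))"
      proof -
        have "k * (2 * x * K / n - x * K / (3 * n)) = 5 * x / 6"
          unfolding k_def using n0 K by (simp add: field_simps)
        then show ?thesis by (simp add: algebra_simps)
      qed
      also have "\<dots> \<le> k * t'" unfolding t'_def using t k by (intro mult_left_mono diff_right_mono) auto
      finally show "3 * (k * W) + sqrt (2 * x * (real (card {0..<n}) * (V / (4 * K\<^sup>2)))) + 5 * x / 6 \<le> k * t'" .
    qed (use V0 W0 k in auto)
    moreover have "measure Q {T \<in> space Q. \<exists>g\<in>S. t' \<le> dev g T} \<le> measure Q {T \<in> space Q. k * t' \<le> ?Z T}"
    proof (rule Q.finite_measure_mono)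
      show "{T \<in> space Q. \<exists>g\<in>S. t' \<le> dev g T} \<subseteq> {T \<in> space Q. k * t' \<le> ?Z T}"
        using Z_ge k by (auto intro: order_trans[OF mult_left_mono])
      show "{T \<in> space Q. k * t' \<le> ?Z T} \<in> sets Q" using Zm by measurable
    qed
    ultimately show ?thesis by linarith
  qed
  \<comment> \<open>Initial segments of an enumeration of \<open>D\<close> give an increasing
    sequence of events, so the bound for finite classes passes to their union by continuity from
    below.\<close>
  define Am where "Am = (\<lambda>m. {T \<in> space Q. \<exists>g\<in>from_nat_into D ` {..m}. t' \<le> dev g T})"
  have DH: "from_nat_into D j \<in> H" for j using from_nat_into[OF Dne] D(2) by auto
  have Ams: "range Am \<subseteq> sets Q"
  proof -
    have "Am m \<in> sets Q" for m
    proof -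
      have [measurable]: "dev (from_nat_into D j) \<in> borel_measurable Q" for j by (rule devm[OF DH])
      have "Am m = {T \<in> space Q. \<exists>j\<le>m. t' \<le> dev (from_nat_into D j) T}" unfolding Am_def by auto
      also have "\<dots> \<in> sets Q" by measurable
      finally show ?thesis .
    qed
    then show ?thesis by auto
  qed
  have "Am m \<subseteq> Am m'" if "m \<le> m'" for m m'
  proof -
    have "from_nat_into D ` {..m} \<subseteq> from_nat_into D ` {..m'}" using that by auto
    then show ?thesis unfolding Am_def by blast
  qed
  then have "incseq Am" by (simp add: incseq_def)
  then have "(\<lambda>m. measure Q (Am m)) \<longlonglongrightarrow> measure Q (\<Union>m. Am m)"
    using Ams by (intro Q.finite_Lim_measure_incseq)
  moreover have "measure Q (Am m) \<le> exp (- x)" for m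
    unfolding Am_def using DH by (intro fin) auto
  ultimately have "measure Q (\<Union>m. Am m) \<le> exp (- x)"
    by (intro LIMSEQ_le_const2) auto
  moreover have "{T \<in> space Q. \<exists>g\<in>H. t \<le> dev g T} \<subseteq> (\<Union>m. Am m)"
  proof safe
    fix T g assume T: "T \<in> space Q" and g: "g \<in> H" "t \<le> dev g T"
    \<comment> \<open>Half of the slack: \<open>dev\<close> is 2-Lipschitz for the supremum norm,
      since the mean and the empirical mean each move by at most the radius.\<close>
    have "x * K / (6 * n) > 0" using x K n0 by simp
    then obtain d where d: "d \<in> D" "\<forall>z\<in>space M. \<bar>g z - d z\<bar> \<le> x * K / (6 * n)"
      using dense[OF g(1)] by blast
    have "\<bar>dev g T - dev d T\<bar> \<le> 2 * (x * K / (6 * n))"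
      using d D(2) by (intro dev_close g T) auto
    also have "\<dots> = x * K / (3 * n)" by simp
    finally have "t' \<le> dev d T" using g(2) unfolding t'_def by linarith
    moreover obtain m where "from_nat_into D m = d" using from_nat_into_surj[OF D(1) d(1)] by blast
    ultimately have "T \<in> Am m" unfolding Am_def using T by auto
    then show "T \<in> (\<Union>m. Am m)" by blast
  qed
  moreover have "(\<Union>m. Am m) \<in> sets Q" using Ams by auto
  ultimately show ?thesis by blast
qed

section \<open>Localization and the oracle inequality\<close>

lemma pw_mono: "0 \<le> x \<Longrightarrow> x \<le> y \<Longrightarrow> 0 \<le> a \<Longrightarrow> pw x a \<le> pw y a"
  by (auto simp: pw_def intro: powr_mono2)

lemma pw_nonneg: "0 \<le> pw x a"
  by (auto simp: pw_def)

text \<open>Every measurable set covering the good event has its complement inside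
  \<open>A\<close>.\<close>

lemma (in prob_space) outer_prob_ge:
  assumes A: "A \<in> sets M" "space M - S \<subseteq> A" "measure M A \<le> p"
  shows "1 - p \<le> outer_prob M (space M \<inter> S)"
  unfolding outer_prob_def
proof (rule cInf_greatest)
  show "{measure M A |A. A \<in> sets M \<and> space M \<inter> S \<subseteq> A} \<noteq> {}" by auto
  fix q assume "q \<in> {measure M A |A. A \<in> sets M \<and> space M \<inter> S \<subseteq> A}"
  then obtain B where B: "B \<in> sets M" "space M \<inter> S \<subseteq> B" "q = measure M B" by auto
  have "measure M (space M - B) \<le> measure M A"
    using A B by (intro finite_measure_mono) auto
  then show "1 - p \<le> q" using A B prob_compl[OF B(1)] by simp
qed

text \<open>Line-continuity gives pointwise convergence; convexity and nonnegativity give the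
  dominating function \<open>C f + C g\<close> on the whole segment.\<close>

lemma continuous_on_line_integral:
  fixes C :: "('z \<Rightarrow> real) \<Rightarrow> 'z \<Rightarrow> real"
  assumes fg: "f \<in> F" "g \<in> F" and int: "integrable P (C f)" "integrable P (C g)"
    and conv: "\<And>t. t \<in> {0..1} \<Longrightarrow> (\<lambda>x. t * f x + (1 - t) * g x) \<in> F"
    and meas: "\<And>f. f \<in> F \<Longrightarrow> C f \<in> borel_measurable P"
    and nonneg: "\<And>f z. f \<in> F \<Longrightarrow> z \<in> space P \<Longrightarrow> 0 \<le> C f z"
    and C_conv: "\<And>t z. t \<in> {0..1} \<Longrightarrow> z \<in> space P \<Longrightarrow>
        C (\<lambda>x. t * f x + (1 - t) * g x) z \<le> t * C f z + (1 - t) * C g z"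
    and cont: "\<And>z. z \<in> space P \<Longrightarrow> continuous_on {0..1} (\<lambda>t. C (\<lambda>x. t * f x + (1 - t) * g x) z)"
  shows "continuous_on {0..1} (\<lambda>t. \<integral>z. C (\<lambda>x. t * f x + (1 - t) * g x) z \<partial>P)"
proof (rule continuous_on_sequentiallyI)
  fix X :: "nat \<Rightarrow> real" and a :: real
  assume X: "\<forall>n. X n \<in> {0..1}" "a \<in> {0..1}" "X \<longlonglongrightarrow> a"
  show "(\<lambda>n. \<integral>z. C (\<lambda>x. X n * f x + (1 - X n) * g x) z \<partial>P)
    \<longlonglongrightarrow> (\<integral>z. C (\<lambda>x. a * f x + (1 - a) * g x) z \<partial>P)"
  proof (rule integral_dominated_convergence[where w = "\<lambda>z. C f z + C g z"])
    show "AE z in P. (\<lambda>n. C (\<lambda>x. X n * f x + (1 - X n) * g x) z) \<longlonglongrightarrow> C (\<lambda>x. a * f x + (1 - a) * g x) z"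
    proof (rule AE_I2)
      fix z assume "z \<in> space P"
      from cont[OF this] X
      show "(\<lambda>n. C (\<lambda>x. X n * f x + (1 - X n) * g x) z) \<longlonglongrightarrow> C (\<lambda>x. a * f x + (1 - a) * g x) z"
        unfolding continuous_on_sequentially comp_def by blast
    qed
    show "AE z in P. norm (C (\<lambda>x. X n * f x + (1 - X n) * g x) z) \<le> C f z + C g z" for n
    proof (rule AE_I2)
      fix z assume z: "z \<in> space P"
      have Xn: "X n \<in> {0..1}" using X by blast
      have "C (\<lambda>x. X n * f x + (1 - X n) * g x) z \<le> X n * C f z + (1 - X n) * C g z"
        by (rule C_conv[OF Xn z])
      also have "\<dots> \<le> 1 * C f z + 1 * C g z"
        using Xn nonneg[OF fg(1) z] nonneg[OF fg(2) z] by (intro add_mono mult_right_mono) auto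
      finally show "norm (C (\<lambda>x. X n * f x + (1 - X n) * g x) z) \<le> C f z + C g z"
        using nonneg[OF conv[OF Xn] z] by simp
    qed
  qed (use X int meas conv in auto)
qed

theorem theorem3p1:
  fixes P :: "'z measure"
    and F :: "('z \<Rightarrow> real) set"
    and C :: "('z \<Rightarrow> real) \<Rightarrow> 'z \<Rightarrow> real"
    and fP :: "'z \<Rightarrow> real"
    and fT :: "nat \<Rightarrow> (nat \<Rightarrow> 'z) \<Rightarrow> ('z \<Rightarrow> real)"
    and b B \<beta> w W \<nu> \<theta> :: real
  assumes P: "prob_space P"
    and F_meas: "\<forall>f\<in>F. f \<in> borel_measurable P \<and> bounded (f ` space P)"
    and F_convex: "\<forall>f\<in>F. \<forall>g\<in>F. \<forall>t\<in>{0..1}. (\<lambda>z. t * f z + (1 - t) * g z) \<in> F"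
    and C_nonneg: "\<forall>f\<in>F. \<forall>z\<in>space P. 0 \<le> C f z"
    and C_meas: "\<forall>f\<in>F. C f \<in> borel_measurable P"
    and C_convex: "\<forall>f\<in>F. \<forall>g\<in>F. \<forall>t\<in>{0..1}. \<forall>z\<in>space P.
        C (\<lambda>x. t * f x + (1 - t) * g x) z \<le> t * C f z + (1 - t) * C g z"
    and C_line_cont: "\<forall>f\<in>F. \<forall>g\<in>F. \<forall>z\<in>space P.
        continuous_on {0..1} (\<lambda>t. C (\<lambda>x. t * f x + (1 - t) * g x) z)"
    and fP_min: "fP \<in> F" "\<forall>f\<in>F. risk C P fP \<le> risk C P f"
    and fT_min: "\<forall>n\<ge>1. \<forall>T\<in>space (sample_measure P n).
        fT n T \<in> F \<and> (\<forall>f\<in>F. emp_risk C n T (fT n T) \<le> emp_risk C n T f)"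
    and G_sep: "sup_separable (space P) ((\<lambda>f z. C f z - C fP z) ` F)"
    and params: "0 \<le> b" "0 \<le> B" "0 \<le> \<beta>" "\<beta> \<le> 1" "0 \<le> w" "0 \<le> W"
        "0 \<le> \<nu>" "\<nu> \<le> 2" "0 \<le> \<theta>" "\<theta> < 2"
    and sup_bound: "\<forall>g\<in>(\<lambda>f z. C f z - C fP z) ` F. \<forall>z\<in>space P.
        \<bar>g z\<bar> \<le> b * pw (\<integral>x. g x \<partial>P) \<beta> + B"
    and var_bound: "\<forall>g\<in>(\<lambda>f z. C f z - C fP z) ` F.
        (\<integral>x. (g x)\<^sup>2 \<partial>P) \<le> pw (b * pw (\<integral>x. g x \<partial>P) \<beta> + B) \<nu>
                              * (w * pw (\<integral>x. g x \<partial>P) \<theta> + W)"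
  shows "\<forall>n::nat. \<forall>x::real. \<forall>\<epsilon>::real. n \<ge> 1 \<longrightarrow> x \<ge> 1 \<longrightarrow> \<epsilon> > 0 \<longrightarrow>
      \<epsilon> \<ge> 3 * modulus P n ((\<lambda>f z. C f z - C fP z) ` F) \<epsilon>
          + sqrt (2 * x * pw (b * pw \<epsilon> \<beta> + B) \<nu> * (w * pw \<epsilon> \<theta> + W) / real n)
          + 2 * x * (b * pw \<epsilon> \<beta> + B) / real n \<longrightarrow>
      outer_prob (sample_measure P n)
        {T \<in> space (sample_measure P n). risk C P (fT n T) < risk C P fP + \<epsilon>}
        \<ge> 1 - exp (- x)"
proof (intro allI impI)
  fix n :: nat and x \<epsilon> :: real
  let ?G = "(\<lambda>f z. C f z - C fP z) ` F"
  let ?K = "b * pw \<epsilon> \<beta> + B" and ?V = "pw (b * pw \<epsilon> \<beta> + B) \<nu> * (w * pw \<epsilon> \<theta> + W)"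
  assume n: "1 \<le> n" and x: "1 \<le> x" and \<epsilon>: "0 < \<epsilon>"
    and cond: "3 * modulus P n ?G \<epsilon> + sqrt (2 * x * pw ?K \<nu> * (w * pw \<epsilon> \<theta> + W) / real n)
          + 2 * x * ?K / real n \<le> \<epsilon>"
  interpret P: prob_space P by (rule P)
  let ?Q = "sample_measure P n"
  interpret Q: prob_space ?Q unfolding sample_measure_def by (intro prob_space_PiM P)
  define good where "good = {T. risk C P (fT n T) < risk C P fP + \<epsilon>}"
  have gm: "g \<in> borel_measurable P" if "g \<in> ?G" for g
    using that C_meas fP_min(1) by (auto intro!: borel_measurable_diff)
  have gi: "integrable P g" if "g \<in> ?G" for g
    by (rule P.integrable_of_bounded[OF gm[OF that] bspec[OF bspec[OF sup_bound that]]])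
  have "\<exists>A\<in>sets ?Q. measure ?Q A \<le> exp (- x) \<and> space ?Q - good \<subseteq> A"
  proof (cases "integrable P (C fP)")
    \<comment> \<open>All members of the class are bounded, hence integrable, so no
      \<open>C f\<close> is integrable if \<open>C fP\<close> is not. Every risk then has the
      default value 0 and no sample is bad.\<close>
    case False
    have "risk C P f = 0" if "f \<in> F" for f
    proof -
      have "\<not> integrable P (C f)"
      proof
        assume "integrable P (C f)"
        then have "integrable P (\<lambda>z. C f z - (C f z - C fP z))"
          by (rule Bochner_Integration.integrable_diff) (use that in \<open>auto intro!: gi\<close>)
        then show False using False by simp
      qed
      then show ?thesis unfolding risk_def by (rule not_integrable_integral_eq)
    qed
    then have "space ?Q - good = {}"
      using fT_min n fP_min(1) \<epsilon> unfolding good_def by auto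
    then show ?thesis by (intro bexI[of _ "{}"]) auto
  next
    case True
    have Ci: "integrable P (C f)" if "f \<in> F" for f
    proof -
      have "integrable P (\<lambda>z. (C f z - C fP z) + C fP z)"
        by (rule Bochner_Integration.integrable_add[OF _ True]) (use that in \<open>auto intro!: gi\<close>)
      then show ?thesis by simp
    qed
    have E_eq: "(\<integral>z. C f z - C fP z \<partial>P) = risk C P f - risk C P fP" if "f \<in> F" for f
      unfolding risk_def using Ci[OF that] Ci[OF fP_min(1)] by simp
    have E0: "0 \<le> (\<integral>z. g z \<partial>P)" if "g \<in> ?G" for g
      using that E_eq fP_min(2) by auto
    \<comment> \<open>The class inside the modulus. On it the bounds depending on the mean of
      \<open>g\<close> become uniform, with \<epsilon> in place of that mean.\<close>
    define H where "H = {g \<in> ?G. (\<integral>z. g z \<partial>P) \<le> \<epsilon>}"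
    have K_mono: "b * pw (\<integral>z. g z \<partial>P) \<beta> + B \<le> ?K" if "g \<in> H" for g
      using that params E0 unfolding H_def by (intro add_right_mono mult_left_mono pw_mono) auto
    have Hb: "\<bar>g z\<bar> \<le> ?K" if "g \<in> H" "z \<in> space P" for g z
      using bspec[OF bspec[OF sup_bound] that(2), of g] K_mono[OF that(1)] that(1)
      unfolding H_def by (auto intro: order_trans)
    have HV: "(\<integral>z. (g z)\<^sup>2 \<partial>P) \<le> ?V" if g: "g \<in> H" for g
    proof -
      have "(\<integral>z. (g z)\<^sup>2 \<partial>P) \<le> pw (b * pw (\<integral>z. g z \<partial>P) \<beta> + B) \<nu> * (w * pw (\<integral>z. g z \<partial>P) \<theta> + W)"
        using bspec[OF var_bound, of g] g unfolding H_def by simp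
      also have "\<dots> \<le> ?V"
        using K_mono[OF g] g E0 params unfolding H_def
        by (intro mult_mono add_right_mono mult_left_mono pw_mono pw_nonneg add_nonneg_nonneg mult_nonneg_nonneg) auto
      finally show ?thesis .
    qed
    have bad: "\<exists>g\<in>H. \<epsilon> \<le> (\<integral>z. g z \<partial>P) - (\<Sum>i<n. g (T i)) / real n"
      "\<epsilon> \<le> ?K" if T: "T \<in> space ?Q" "T \<notin> good" for T
    proof -
      have "fT n T \<in> F" and fmin: "\<And>f. f \<in> F \<Longrightarrow> emp_risk C n T (fT n T) \<le> emp_risk C n T f"
        using fT_min n T(1) by blast+
      define f where "f = fT n T"
      have f: "f \<in> F" unfolding f_def by fact
      have Tsp: "T i \<in> space P" if "i < n" for i
        using T(1) that unfolding sample_measure_def by (auto simp: space_PiM PiE_def)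
      define mix where "mix = (\<lambda>t x. t * f x + (1 - t) * fP x)"
      have mixF: "mix t \<in> F" if "t \<in> {0..1}" for t
        unfolding mix_def using F_convex f fP_min(1) that by blast
      have "continuous_on {0..1} (\<lambda>t. risk C P (mix t))"
        unfolding risk_def mix_def
        by (rule continuous_on_line_integral[OF f fP_min(1) Ci Ci])
           (use C_meas C_nonneg C_convex C_line_cont F_convex f fP_min(1) in auto)
      moreover have "risk C P (mix 0) \<le> risk C P fP + \<epsilon>" "risk C P fP + \<epsilon> \<le> risk C P (mix 1)"
        using T(2) \<epsilon> unfolding mix_def good_def f_def by auto
      ultimately obtain t where t: "0 \<le> t" "t \<le> 1" "risk C P (mix t) = risk C P fP + \<epsilon>"
        using IVT'[of "\<lambda>t. risk C P (mix t)" 0 "risk C P fP + \<epsilon>" 1] by auto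
      define g where "g = (\<lambda>z. C (mix t) z - C fP z)"
      have gG: "g \<in> ?G" unfolding g_def using mixF t by auto
      have Eg: "(\<integral>z. g z \<partial>P) = \<epsilon>" unfolding g_def using E_eq[OF mixF, of t] t by simp
      have gH: "g \<in> H" unfolding H_def using gG Eg by simp
      have "(\<Sum>i<n. g (T i)) \<le> (\<Sum>i<n. t * (C f (T i) - C fP (T i)))"
      proof (rule sum_mono)
        fix i assume "i \<in> {..<n}"
        then have "C (mix t) (T i) \<le> t * C f (T i) + (1 - t) * C fP (T i)"
          unfolding mix_def using C_convex f fP_min(1) t Tsp by auto
        then show "g (T i) \<le> t * (C f (T i) - C fP (T i))" unfolding g_def by (simp add: algebra_simps)
      qed
      also have "\<dots> = t * ((\<Sum>i<n. C f (T i)) - (\<Sum>i<n. C fP (T i)))"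
        by (simp add: sum_distrib_left[symmetric] sum_subtractf)
      also have "\<dots> \<le> 0"
      proof (rule mult_nonneg_nonpos[OF t(1)])
        show "(\<Sum>i<n. C f (T i)) - (\<Sum>i<n. C fP (T i)) \<le> 0"
          using fmin[OF fP_min(1)] n unfolding emp_risk_def f_def by (simp add: divide_le_cancel)
      qed
      finally have "(\<Sum>i<n. g (T i)) / real n \<le> 0" by (simp add: divide_nonpos_nonneg)
      then show "\<exists>g\<in>H. \<epsilon> \<le> (\<integral>z. g z \<partial>P) - (\<Sum>i<n. g (T i)) / real n"
        using gH Eg by (intro bexI[of _ g]) auto
      \<comment> \<open>The mean \<epsilon> of \<open>g\<close> cannot exceed its uniform bound. So
        there are no bad samples when \<open>?K\<close> is not positive, which is the case where
        scaling by 2K is impossible.\<close>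
      have "(\<integral>z. g z \<partial>P) \<in> {- ?K..?K}"
      proof (rule P.expectation_in_bounds[OF gm[OF gG]])
        show "g z \<in> {- ?K..?K}" if "z \<in> space P" for z
          using Hb[OF gH that] unfolding atLeastAtMost_iff abs_le_iff by linarith
      qed
      then show "\<epsilon> \<le> ?K" using Eg by simp
    qed
    show ?thesis
    proof (cases "0 < ?K")
      case False
      then have "space ?Q - good = {}" using bad(2) \<epsilon> by fastforce
      then show ?thesis by (intro bexI[of _ "{}"]) auto
    next
      case K: True
      have "\<exists>A\<in>sets ?Q. measure ?Q A \<le> exp (- x) \<and>
        {T \<in> space ?Q. \<exists>g\<in>H. \<epsilon> \<le> (\<integral>z. g z \<partial>P) - (\<Sum>i<n. g (T i)) / real n} \<subseteq> A"
        unfolding sample_measure_def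
      proof (rule P.empirical_sup_tail[OF _ _ _ K _ HV n])
        show "sup_separable (space P) H"
          by (rule sup_separable_subset[OF G_sep]) (auto simp: H_def)
        \<comment> \<open>The zero function, coming from \<open>fP\<close> itself, witnesses that
          the localized class is nonempty.\<close>
        have "(\<lambda>z. C fP z - C fP z) \<in> ?G" using fP_min(1) by (rule imageI)
        then have "(\<lambda>z. C fP z - C fP z) \<in> H" unfolding H_def using \<epsilon> by simp
        then show "H \<noteq> {}" by auto
        show "3 * (\<integral>T. (SUP g\<in>H. \<bar>(\<integral>z. g z \<partial>P) - (\<Sum>i<n. g (T i)) / real n\<bar>) \<partial>PiM {0..<n} (\<lambda>_. P))
          + sqrt (2 * x * ?V / real n) + 2 * x * ?K / real n \<le> \<epsilon>"
          using cond unfolding modulus_def H_def sample_measure_def by (simp only: mult.assoc)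
      qed (use gm Hb x in \<open>auto simp: H_def\<close>)
      then show ?thesis using bad(1) by blast
    qed
  qed
  then have "1 - exp (- x) \<le> outer_prob ?Q (space ?Q \<inter> good)"
    using Q.outer_prob_ge by blast
  then show "1 - exp (- x) \<le> outer_prob ?Q {T \<in> space ?Q. risk C P (fT n T) < risk C P fP + \<epsilon>}"
    by (simp add: good_def Collect_conj_eq)
qed

end
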